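(* Let $X=\{x_1,\dots,x_n\}$, let $p\ge1$, and let $\mathrm{UT}(n)$ act on $F_n(\mathfrak N_p)=\mathbb C\langle X\rangle/I_{p+1}$. Then $$\beta(F_n(\mathfrak N_p)^{\mathrm{UT}(n)})\le\begin{cases} n(p-1) & \text{if } p>1,\\ 1 & \text{if } p=1.\end{cases}$$
   Context: $V$ is the $\mathbb C$-vector space with basis $X$, and $\mathbb C\langle X\rangle$ is the free (unital) associative algebra on $X$, identified with the tensor algebra $T(V)$. Left-normed commutators: $[u_1,u_2]=u_1u_2-u_2u_1$ and $[u_1,\dots,u_i]=[[u_1,\dots,u_{i-1}],u_i]$ for $i\ge 3$. For $m\ge 2$, $I_m$ is the two-sided ideal of $\mathbb C\langle X\rangle$ generated by all commutators $[u_1,\dots,u_m]$ with $u_1,\dots,u_m\in\mathbb C\langle X\rangle$. $\mathrm{GL}(n)=\mathrm{GL}(V,\mathbb C)$ acts on $V$ and, diagonally by algebra automorphisms, on $\mathbb C\langle X\rangle$ and on the quotient $F_n(\mathfrak N_p)$. $\mathrm{UT}(n)=\mathrm{UT}(n,\mathbb C)$ is the unitriangular group: the subgroup of $\mathrm{GL}(n)$ consisting of the upper triangular matrices with $1$'s on the diagonal (with respect to the basis $x_1,\dots,x_n$, so that $x_1$ is fixed). $F_n(\mathfrak N_p)$ and its subalgebra of invariants are graded by total degree (each $x_i$ of degree $1$). For a graded algebra $A=\bigoplus_{i\ge0}A^i$, $\beta(A)$ denotes the minimal non-negative integer $i$ such that $A$ is generated (as a unital algebra) by homogeneous elements of degree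 at most $i$, and $\beta(A)=\infty$ if there is no such $i$. *)

theory Defs
  imports
    "HOL-Analysis.Cartesian_Space"
    "HOL-Algebra.Algebraic_Closure_Type"
    "HOL-Algebra.Generated_Rings"
    "HOL-Library.Poly_Mapping"
    "HOL-Library.Extended_Nat"
begin


section \<open>The free associative algebra\<close>

text \<open>
  Words form the free monoid, written additively because finitely supported functions
  (type \<open>\<Rightarrow>\<^sub>0\<close>) take their convolution product from addition on the index type.
\<close>

instantiation list :: (type) monoid_add
begin

definition zero_list :: "'a list" where "0 = []"
definition plus_list :: "'a list \<Rightarrow> 'a list \<Rightarrow> 'a list" where "xs + ys = xs @ ys"

instance by intro_classes (simp_all add: zero_list_def plus_list_def)

end

text \<open>
  The variables \<open>x\<^sub>1, \<dots>, x\<^sub>n\<close> are indexed by a finite linearly ordered type \<open>'n\<close>, so that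
  \<open>n = CARD('n)\<close> and \<open>x\<^sub>1\<close> belongs to the least element of \<open>'n\<close>.
\<close>

type_synonym 'n free_alg = "'n list \<Rightarrow>\<^sub>0 complex"

definition var :: "'n \<Rightarrow> 'n free_alg" where
  "var j = Poly_Mapping.single [j] 1"

definition scalar :: "complex \<Rightarrow> 'n free_alg" where
  "scalar c = Poly_Mapping.single [] c"

abbreviation free_ring :: "'n free_alg ring" where
  "free_ring \<equiv> ring_of_type_algebra"

definition homogeneous :: "nat \<Rightarrow> 'n free_alg set" where
  "homogeneous i = {f. \<forall>w\<in>Poly_Mapping.keys f. length w = i}"


section \<open>The relatively free algebras\<close>

definition commutator :: "'a::ring \<Rightarrow> 'a \<Rightarrow> 'a" where
  "commutator u v = u * v - v * u"

text \<open>\<open>left_normed u [v\<^sub>2, \<dots>, v\<^sub>m]\<close> is \<open>[u, v\<^sub>2, \<dots>, v\<^sub>m] = [[\<dots>[u, v\<^sub>2], \<dots>], v\<^sub>m]\<close>.\<close>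

definition left_normed :: "'a::ring \<Rightarrow> 'a list \<Rightarrow> 'a" where
  "left_normed u vs = foldl commutator u vs"

definition comm_ideal :: "nat \<Rightarrow> 'n free_alg set" where
  "comm_ideal m = Idl\<^bsub>free_ring\<^esub> {left_normed u vs | u vs. Suc (length vs) = m}"

definition rel_free :: "nat \<Rightarrow> 'n free_alg set ring" where
  "rel_free p = free_ring Quot comm_ideal (Suc p)"

definition proj :: "nat \<Rightarrow> 'n free_alg \<Rightarrow> 'n free_alg set" where
  "proj p f = comm_ideal (Suc p) +>\<^bsub>free_ring\<^esub> f"


section \<open>The action of the general linear group\<close>

definition linear_form :: "complex^'n \<Rightarrow> 'n free_alg" where
  "linear_form v = (\<Sum>i\<in>UNIV. scalar (v $ i) * var i)"

text \<open>
  A matrix sends \<open>x\<^sub>j\<close> to the linear form whose coefficients are its \<open>j\<close>-th column, and a word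
  \<open>x\<^sub>j x\<^sub>k \<dots>\<close> to the product of the images of its letters.
\<close>

definition gl_act :: "complex^'n^'n \<Rightarrow> 'n free_alg \<Rightarrow> 'n free_alg" where
  "gl_act A f = (\<Sum>w\<in>Poly_Mapping.keys f.
     scalar (Poly_Mapping.lookup f w) * prod_list (map (\<lambda>j. linear_form (column j A)) w))"

text \<open>
  On the quotient, the image of a coset under an invertible \<open>A\<close> is again a coset
  (lemma \<open>gl_act_proj\<close> below), namely that of the image of any representative.
\<close>

definition gl_act_quot :: "complex^'n^'n \<Rightarrow> 'n free_alg set \<Rightarrow> 'n free_alg set" where
  "gl_act_quot A C = gl_act A ` C"

definition GL :: "(complex^'n^'n) set" where
  "GL = {A. invertible A}"

definition UT :: "(complex^'n::{finite,linorder}^'n::_) set" where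
  "UT = {A \<in> GL. (\<forall>i j. j < i \<longrightarrow> A $ i $ j = 0) \<and> (\<forall>i. A $ i $ i = 1)}"

definition invariants :: "(complex^'n^'n) set \<Rightarrow> nat \<Rightarrow> 'n free_alg set ring" where
  "invariants G p = (rel_free p)
     \<lparr>carrier := {C \<in> carrier (rel_free p). \<forall>A\<in>G. gl_act_quot A C = C}\<rparr>"

definition invariants_component ::
    "(complex^'n^'n) set \<Rightarrow> nat \<Rightarrow> nat \<Rightarrow> 'n free_alg set set" where
  "invariants_component G p i = carrier (invariants G p) \<inter> proj p ` homogeneous i"


section \<open>The degree bound for generators\<close>

text \<open>
  \<open>A\<close> is a ring, \<open>K\<close> the image in \<open>A\<close> of the field of scalars, and \<open>H i\<close> the homogeneous
  component of degree \<open>i\<close>; the unital subalgebra generated by \<open>S\<close> is the subring generated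
  by \<open>K \<union> S\<close>. The infimum of the empty set is \<open>\<infinity>\<close>.
\<close>

definition beta :: "('a, 'b) ring_scheme \<Rightarrow> 'a set \<Rightarrow> (nat \<Rightarrow> 'a set) \<Rightarrow> enat" where
  "beta A K H =
     Inf (enat ` {i. \<exists>S \<subseteq> (\<Union>j\<le>i. H j). generate_ring A (K \<union> S) = carrier A})"

definition beta_invariants :: "(complex^'n^'n) set \<Rightarrow> nat \<Rightarrow> enat" where
  "beta_invariants G p =
     beta (invariants G p) (range (\<lambda>c. proj p (scalar c))) (invariants_component G p)"


section \<open>Well-definedness\<close>

lemma ring_free_ring: "ring (free_ring :: 'n free_alg ring)"
proof -
  have "\<exists>y. y + x = 0" for x :: "'n free_alg"
    by (rule exI[of _ "- x"]) simp
  then show ?thesis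
    by unfold_locales
      (auto simp: ring_of_type_algebra_def algebra_simps Units_def)
qed

lemma ideal_comm_ideal: "ideal (comm_ideal m) (free_ring :: 'n free_alg ring)"
  unfolding comm_ideal_def
  by (rule ring.genideal_ideal[OF ring_free_ring]) (simp add: ring_of_type_algebra_def)

lemma ring_rel_free: "ring (rel_free p)"
  unfolding rel_free_def by (rule ideal.quotient_is_ring[OF ideal_comm_ideal])

lemma proj_eq: "proj p f = (\<lambda>h. h + f) ` comm_ideal (Suc p)"
  by (auto simp: proj_def a_r_coset_def r_coset_def ring_of_type_algebra_def)

lemma carrier_rel_free: "carrier (rel_free p) = range (proj p)"
  by (auto simp: rel_free_def FactRing_def A_RCOSETS_def RCOSETS_def proj_def a_r_coset_def
      ring_of_type_algebra_def)

lemma scalar_add: "scalar (a + b) = scalar a + scalar b"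
  by (simp add: scalar_def single_add)

lemma scalar_mult: "scalar (a * b) = scalar a * scalar b"
  by (simp add: scalar_def mult_single plus_list_def)

lemma scalar_0: "scalar 0 = 0" and scalar_1: "scalar 1 = 1"
  by (simp_all add: scalar_def single_one[symmetric] zero_list_def)

lemma free_alg_induct [case_names single sum]:
  fixes f :: "'n free_alg"
  assumes single: "\<And>w c. P (Poly_Mapping.single w c)"
    and sum: "\<And>f g. P f \<Longrightarrow> P g \<Longrightarrow> P (f + g)"
  shows "P f"
proof (induction f rule: update_induct)
  case const
  show ?case using single[of "[]" 0] by simp
next
  case (update f w c)
  have "Poly_Mapping.update w c f = f + Poly_Mapping.single w c"
    using update.hyps(1)
    by (intro poly_mapping_eqI) (auto simp: lookup_update lookup_add lookup_single in_keys_iff when_def)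
  with update show ?case by (simp add: single sum)
qed

lemma scalar_commute: "scalar c * f = f * scalar c"
proof (induction f rule: free_alg_induct)
  case (single w a)
  then show ?case by (simp add: scalar_def mult_single plus_list_def mult.commute)
next
  case (sum f g)
  then show ?case by (simp add: algebra_simps)
qed

lemma gl_act_superset:
  assumes "finite W" "Poly_Mapping.keys f \<subseteq> W"
  shows "gl_act A f = (\<Sum>w\<in>W.
     scalar (Poly_Mapping.lookup f w) * prod_list (map (\<lambda>j. linear_form (column j A)) w))"
  unfolding gl_act_def
  by (rule sum.mono_neutral_left) (use assms in \<open>auto simp: in_keys_iff scalar_0\<close>)

lemma gl_act_add: "gl_act A (f + g) = gl_act A f + gl_act A g"
proof -
  let ?W = "Poly_Mapping.keys f \<union> Poly_Mapping.keys g"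
  have "finite ?W" by simp
  note * = gl_act_superset[OF this]
  show ?thesis
    by (subst (1 2 3) *) (use Poly_Mapping.keys_add[of f g] in
      \<open>auto simp: lookup_add scalar_add distrib_right sum.distrib\<close>)
qed

lemma gl_act_single:
  "gl_act A (Poly_Mapping.single w c) = scalar c * prod_list (map (\<lambda>j. linear_form (column j A)) w)"
  by (simp add: gl_act_def scalar_0)

lemma gl_act_scalar [simp]: "gl_act A (scalar c) = scalar c"
  by (simp add: scalar_def gl_act_single)

lemma gl_act_0 [simp]: "gl_act A 0 = 0" and gl_act_1 [simp]: "gl_act A 1 = 1"
  using gl_act_scalar[of A 0] gl_act_scalar[of A 1] by (simp_all only: scalar_0 scalar_1)

lemma gl_act_uminus: "gl_act A (- f) = - gl_act A f"
  using gl_act_add[of A "- f" f] by (simp add: eq_neg_iff_add_eq_0)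

lemma gl_act_diff: "gl_act A (f - g) = gl_act A f - gl_act A g"
  using gl_act_add[of A f "- g"] by (simp add: gl_act_uminus)

lemma gl_act_sum: "gl_act A (sum f I) = (\<Sum>i\<in>I. gl_act A (f i))"
  by (induction I rule: infinite_finite_induct) (simp_all add: gl_act_add)

lemma gl_act_mult: "gl_act A (f * g) = gl_act A f * gl_act A g"
proof (induction f rule: free_alg_induct)
  case (single v a)
  show ?case
  proof (induction g rule: free_alg_induct)
    case (single w b)
    let ?q = "\<lambda>w. prod_list (map (\<lambda>j. linear_form (column j A)) w)"
    have "scalar a * ?q v * (scalar b * ?q w) = scalar a * (?q v * scalar b) * ?q w"
      by (simp add: mult.assoc)
    also have "\<dots> = scalar (a * b) * ?q (v + w)"
      by (simp only: scalar_commute[of b "?q v", symmetric])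
        (simp add: scalar_mult plus_list_def mult.assoc)
    finally show ?case by (simp add: mult_single gl_act_single)
  next
    case (sum f g)
    then show ?case by (simp add: distrib_left gl_act_add)
  qed
next
  case (sum f g)
  then show ?case by (simp add: distrib_right gl_act_add)
qed

lemma gl_act_prod_list: "gl_act A (prod_list fs) = prod_list (map (gl_act A) fs)"
  by (induction fs) (simp_all add: gl_act_mult)

lemma gl_act_var: "gl_act A (var j) = linear_form (column j A)"
  by (simp add: var_def gl_act_single scalar_1)

lemma scalar_sum: "scalar (sum f I) = (\<Sum>i\<in>I. scalar (f i))"
  by (induction I rule: infinite_finite_induct) (simp_all add: scalar_add scalar_0)

lemma gl_act_linear_form: "gl_act A (linear_form v) = linear_form (A *v v)"
proof -
  have "gl_act A (linear_form v) =
      (\<Sum>j\<in>UNIV. \<Sum>i\<in>UNIV. scalar (v $ j) * (scalar (A $ i $ j) * var i))"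
    by (simp add: linear_form_def gl_act_sum gl_act_mult gl_act_var column_def sum_distrib_left)
  also have "\<dots> = (\<Sum>i\<in>UNIV. \<Sum>j\<in>UNIV. scalar (v $ j) * (scalar (A $ i $ j) * var i))"
    by (rule sum.swap)
  also have "\<dots> = linear_form (A *v v)"
    by (simp add: linear_form_def matrix_vector_mult_def scalar_sum sum_distrib_right
        scalar_mult mult.assoc[symmetric]) (simp add: scalar_mult[symmetric] mult.commute)
  finally show ?thesis .
qed

lemma gl_act_compose: "gl_act A (gl_act B f) = gl_act (A ** B) f"
proof (induction f rule: free_alg_induct)
  case (single w c)
  have "A *v column j B = column j (A ** B)" for j
    by (simp add: vec_eq_iff matrix_vector_mult_def matrix_matrix_mult_def column_def)
  then show ?case
    by (simp add: gl_act_single gl_act_mult gl_act_prod_list gl_act_linear_form o_def)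
next
  case (sum f g)
  then show ?case by (simp add: gl_act_add)
qed

lemma gl_act_one: "gl_act (mat 1) f = (f :: 'n::finite free_alg)"
proof (induction f rule: free_alg_induct)
  case (single w c)
  have "linear_form (column j (mat 1)) = var j" for j :: "'n::finite"
  proof -
    have "linear_form (column j (mat 1)) = (\<Sum>i\<in>UNIV. if i = j then var i else 0)"
      unfolding linear_form_def
      by (rule sum.cong) (auto simp: column_def mat_def scalar_0 scalar_1)
    then show ?thesis by simp
  qed
  moreover have "prod_list (map var w) = Poly_Mapping.single w 1" for w :: "'n::finite list"
    by (induction w)
      (simp_all add: var_def mult_single plus_list_def single_one[symmetric] zero_list_def)
  ultimately show ?case
    by (simp add: gl_act_single scalar_def mult_single plus_list_def)
next
  case (sum f g)
  then show ?case by (simp add: gl_act_add)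
qed

lemma gl_act_left_normed: "gl_act A (left_normed u vs) = left_normed (gl_act A u) (map (gl_act A) vs)"
  unfolding left_normed_def
  by (induction vs arbitrary: u) (simp_all add: commutator_def gl_act_diff gl_act_mult)

lemma gl_act_ring_hom: "gl_act A \<in> ring_hom free_ring free_ring"
  by (rule ring_hom_memI) (simp_all add: ring_of_type_algebra_def gl_act_add gl_act_mult)

lemma gl_act_comm_ideal:
  fixes f :: "'n::finite free_alg"
  assumes "f \<in> comm_ideal m"
  shows "gl_act A f \<in> comm_ideal m"
proof -
  let ?G = "{left_normed u vs | u vs. Suc (length vs) = m} :: 'n free_alg set"
  let ?J = "{f :: 'n free_alg. f \<in> carrier free_ring \<and> gl_act A f \<in> comm_ideal m}"
  have "ring_hom_ring free_ring free_ring (gl_act A)"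
    by (intro ring_hom_ringI2 ring_free_ring gl_act_ring_hom)
  then have "ideal ?J free_ring"
    by (rule ring_hom_ring.ideal_vimage[OF _ ideal_comm_ideal])
  moreover have "?G \<subseteq> ?J"
  proof
    fix g assume "g \<in> ?G"
    then obtain u vs where "g = left_normed u vs" "Suc (length vs) = m" by blast
    then have "gl_act A g = left_normed (gl_act A u) (map (gl_act A) vs)"
      and "Suc (length (map (gl_act A) vs)) = m"
      by (simp_all add: gl_act_left_normed)
    then have "gl_act A g \<in> ?G" by blast
    moreover have "?G \<subseteq> comm_ideal m"
      unfolding comm_ideal_def
      by (rule ring.genideal_self[OF ring_free_ring]) (simp add: ring_of_type_algebra_def)
    ultimately show "g \<in> ?J" by (auto simp: ring_of_type_algebra_def)
  qed
  ultimately have "comm_ideal m \<subseteq> ?J"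
    unfolding comm_ideal_def[of m] by (rule ring.genideal_minimal[OF ring_free_ring])
  with assms show ?thesis by blast
qed

lemma gl_act_proj:
  fixes f :: "'n::finite free_alg"
  assumes "A \<in> GL"
  shows "gl_act_quot A (proj p f) = proj p (gl_act A f)"
proof -
  from assms obtain B where B: "A ** B = mat 1"
    by (auto simp: GL_def invertible_def)
  have "gl_act A ` comm_ideal (Suc p) = (comm_ideal (Suc p) :: 'n free_alg set)"
  proof (intro equalityI subsetI)
    fix h :: "'n free_alg" assume "h \<in> comm_ideal (Suc p)"
    then have "gl_act B h \<in> comm_ideal (Suc p)" by (rule gl_act_comm_ideal)
    moreover have "h = gl_act A (gl_act B h)" by (simp add: gl_act_compose B gl_act_one)
    ultimately show "h \<in> gl_act A ` comm_ideal (Suc p)" by blast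
  qed (auto intro: gl_act_comm_ideal)
  moreover have "gl_act_quot A (proj p f) =
      (\<lambda>h. h + gl_act A f) ` gl_act A ` comm_ideal (Suc p)"
    by (simp add: gl_act_quot_def proj_eq image_image gl_act_add)
  ultimately show ?thesis by (simp only: proj_eq)
qed

end

theory Submission
  imports Defs
begin

text \<open>
  Write \<open>I\<close> for the ideal of the relatively free algebra and \<open>D = [\<cdot>, x]\<close> for a variable \<open>x\<close>.
  Expressions in which \<open>D\<close> is applied \<open>p\<close> times, with left multiplications in between, lie in
  \<open>I\<close>; moving the letters \<open>x\<close> of a word to the left shows that an element of degree at least
  \<open>p\<close> in \<open>x\<close> is a multiple \<open>x g\<close> modulo \<open>I\<close>. An invariant of \<open>UT\<close> has only components whose
  degree in \<open>x\<^sub>1\<close> is at least that in any other variable, by \<open>\<ss>\<ll>\<^sub>2\<close>-theory, so an invariant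
  of total degree above \<open>n(p - 1)\<close> has the form \<open>x\<^sub>1 g\<close>. As \<open>x\<^sub>1\<close> is fixed by \<open>UT\<close> and is not
  a zero divisor modulo \<open>I\<close>, the cofactor \<open>g\<close> is again invariant, and induction on the degree
  applies.
\<close>

section \<open>Iterated commutators with a fixed element\<close>

text \<open>The index counts brackets: \<open>comm_span m\<close> is spanned by commutators of length \<open>m + 1\<close>.\<close>

inductive_set comm_span :: "nat \<Rightarrow> 'a::ring_1 set" for m where
  gen: "length vs = m \<Longrightarrow> left_normed u vs \<in> comm_span m"
| add: "f \<in> comm_span m \<Longrightarrow> g \<in> comm_span m \<Longrightarrow> f + g \<in> comm_span m"

lemma left_normed_Nil: "left_normed u [] = u"
  by (simp add: left_normed_def)

lemma left_normed_snoc: "left_normed u (vs @ [v]) = commutator (left_normed u vs) v"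
  by (simp add: left_normed_def)

lemma left_normed_0: "left_normed 0 vs = 0"
  unfolding left_normed_def by (induction vs) (simp_all add: commutator_def)

lemma commutator_add_left: "commutator (f + g) v = commutator f v + commutator g v"
  by (simp add: commutator_def algebra_simps)

lemma comm_span_0: "comm_span 0 = UNIV"
  using comm_span.gen[of "[]" 0] by (auto simp: left_normed_Nil)

lemma zero_in_comm_span: "0 \<in> comm_span m"
  using comm_span.gen[of "replicate m 0" m 0] by (simp add: left_normed_0)

lemma comm_span_commutator:
  assumes "f \<in> comm_span m"
  shows "commutator f v \<in> comm_span (Suc m)"
  using assms
proof induction
  case (gen vs u)
  then show ?case using comm_span.gen[of "vs @ [v]" "Suc m" u] by (simp add: left_normed_snoc)
next
  case (add f g)
  then show ?case by (simp add: commutator_add_left comm_span.add)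
qed

text \<open>The Leibniz rule differentiates one entry of a commutator at a time, which yields a sum
  of left-normed commutators of the same length.\<close>

lemma comm_span_derivation:
  assumes add: "\<And>f g. \<delta> (f + g) = \<delta> f + \<delta> g"
    and mult: "\<And>f g. \<delta> (f * g) = \<delta> f * g + f * \<delta> g"
    and "f \<in> comm_span m"
  shows "\<delta> f \<in> comm_span m"
  using assms(3)
proof induction
  case (gen vs u)
  have comm: "\<delta> (commutator f v) = commutator (\<delta> f) v + commutator f (\<delta> v)" for f v
  proof -
    \<comment> \<open>Splitting \<open>f * v\<close> as \<open>commutator f v + v * f\<close> uses
      only additivity, so that \<open>\<delta>\<close> need not be known on differences.\<close>
    have "\<delta> (f * v) = \<delta> (commutator f v) + \<delta> (v * f)"
      by (simp add: commutator_def flip: add)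
    then show ?thesis by (simp add: mult commutator_def algebra_simps)
  qed
  from gen show ?case
  proof (induction vs arbitrary: m rule: rev_induct)
    case Nil
    then show ?case by (simp add: comm_span_0)
  next
    case (snoc v vs)
    from snoc.prems obtain k where k: "m = Suc k" "length vs = k" by auto
    show ?case
      using snoc.IH[OF k(2)] comm_span.gen[OF k(2), of u]
      by (simp add: left_normed_snoc comm k comm_span.add comm_span_commutator)
  qed
next
  case (add f g)
  then show ?case by (simp add: assms(1) comm_span.add)
qed

text \<open>Elements built with \<open>q\<close> brackets against \<open>x\<close>, with an
  arbitrary left factor at each bracket and sums at every level. Unlike \<open>comm_span q\<close>
  in general, this form survives multiplication on either side.\<close>

inductive nested :: "'a::ring_1 \<Rightarrow> nat \<Rightarrow> 'a \<Rightarrow> bool" for x where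
  base: "nested x 0 f"
| step: "nested x q f \<Longrightarrow> nested x (Suc q) (b * commutator f x)"
| add: "nested x q f \<Longrightarrow> nested x q g \<Longrightarrow> nested x q (f + g)"

text \<open>Sums of elements of \<open>comm_span m\<close> times powers of \<open>x\<close>. Only
  powers of \<open>x\<close> stand on the right: they commute with \<open>x\<close> and so pass out
  of a further bracket.\<close>

inductive_set comm_span_powers :: "'a::ring_1 \<Rightarrow> nat \<Rightarrow> 'a set" for x m where
  base: "f \<in> comm_span m \<Longrightarrow> f \<in> comm_span_powers x m"
| mult: "f \<in> comm_span_powers x m \<Longrightarrow> f * x \<in> comm_span_powers x m"
| add: "f \<in> comm_span_powers x m \<Longrightarrow> g \<in> comm_span_powers x m \<Longrightarrow> f + g \<in> comm_span_powers x m"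

text \<open>
  The identity \<open>b[l, x] = [l, bx] - [l, b]x\<close> turns a commutator with a left factor into a
  combination of commutators without one.
\<close>

lemma nested_imp_comm_span_powers: "nested x q f \<Longrightarrow> f \<in> comm_span_powers x q"
proof (induction rule: nested.induct)
  case (base f)
  then show ?case by (simp add: comm_span_powers.base comm_span_0)
next
  case (step q f b)
  show ?case using step.IH
  proof induction
    case (base l)
    \<comment> \<open>The sign is moved into the entry \<open>- b\<close>, because closure is
      available for sums.\<close>
    have "b * commutator l x = commutator l (b * x) + commutator l (- b) * x"
      by (simp add: commutator_def algebra_simps)
    with base show ?case
      by (simp add: comm_span_powers.intros comm_span_commutator)
  next
    case (mult l)
    have "b * commutator (l * x) x = b * commutator l x * x"
      by (simp add: commutator_def algebra_simps)
    with mult.IH show ?case by (simp add: comm_span_powers.mult)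
  next
    case (add l l')
    then show ?case
      by (simp add: commutator_add_left distrib_left comm_span_powers.add)
  qed
qed (rule comm_span_powers.add)

lemma nested_left_mult: "nested x q f \<Longrightarrow> nested x q (a * f)"
proof (induction rule: nested.induct)
  case (step q f b)
  then show ?case using nested.step[of x q f "a * b"] by (simp add: mult.assoc)
qed (simp_all add: distrib_left nested.intros)

text \<open>The innermost bracket can be absorbed, as the innermost entry is arbitrary.\<close>

lemma nested_Suc_imp: "nested x (Suc q) f \<Longrightarrow> nested x q f"
proof (induction "Suc q" f arbitrary: q rule: nested.induct)
  case (step q f b)
  show ?case
  proof (cases q)
    case 0
    then show ?thesis by (simp add: nested.base)
  next
    case (Suc k)
    with step.hyps(2)[of k] show ?thesis by (simp add: nested.step)
  qed
qed (rule nested.add)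

text \<open>By induction on \<open>f\<close>, with \<open>b[f, x]g = b([fg, x] - f[g, x])\<close>.
  The aim is right multiplication, where \<open>j = 0\<close>; the induction needs every
  \<open>j\<close> because \<open>[g, x]\<close> has one bracket more than \<open>g\<close>.\<close>

lemma nested_mult:
  assumes "nested x i f" "nested x j g"
  shows "nested x (i + j) (f * g)"
  using assms
proof (induction arbitrary: g j)
  case (base f)
  then show ?case by (simp add: nested_left_mult)
next
  case (step q f b)
  have "nested x (Suc (q + j)) (commutator (f * g) x)"
    using nested.step[OF step.IH[OF step.prems], of 1] by simp
  moreover have "nested x (Suc (q + j)) (f * commutator (- g) x)"
    using step.IH[OF nested.step[OF nested_left_mult[OF step.prems, of "- 1"], of 1]] by simp
  ultimately have "nested x (Suc (q + j)) (b * (commutator (f * g) x + f * commutator (- g) x))"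
    by (rule nested_left_mult[OF nested.add])
  then show ?case by (simp add: commutator_def algebra_simps)
next
  case (add q f f')
  then show ?case by (simp add: distrib_right nested.add)
qed

lemma nested_right_mult: "nested x q f \<Longrightarrow> nested x q (f * a)"
  using nested_mult[of x q f 0 a] by (simp add: nested.base)


section \<open>The ideal generated by commutators\<close>

lemma comm_ideal_zero: "0 \<in> comm_ideal m"
  using additive_subgroup.zero_closed[OF ideal.axioms(1)[OF ideal_comm_ideal]]
  by (simp add: ring_of_type_algebra_def)

lemma comm_ideal_add: "f \<in> comm_ideal m \<Longrightarrow> g \<in> comm_ideal m \<Longrightarrow> f + g \<in> comm_ideal m"
  using additive_subgroup.a_closed[OF ideal.axioms(1)[OF ideal_comm_ideal]]
  by (auto simp add: ring_of_type_algebra_def)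

lemma comm_ideal_left: "f \<in> comm_ideal m \<Longrightarrow> g * f \<in> comm_ideal m"
  using ideal.I_l_closed[OF ideal_comm_ideal] by (auto simp add: ring_of_type_algebra_def)

lemma comm_ideal_right: "f \<in> comm_ideal m \<Longrightarrow> f * g \<in> comm_ideal m"
  using ideal.I_r_closed[OF ideal_comm_ideal] by (auto simp add: ring_of_type_algebra_def)

lemma comm_ideal_uminus: "f \<in> comm_ideal m \<Longrightarrow> - f \<in> comm_ideal m"
  using comm_ideal_left[of f m "- 1"] by simp

lemma comm_ideal_diff: "f \<in> comm_ideal m \<Longrightarrow> g \<in> comm_ideal m \<Longrightarrow> f - g \<in> comm_ideal m"
  using comm_ideal_add[of f m "- g"] by (simp add: comm_ideal_uminus)

lemma comm_ideal_sum: "(\<And>i. i \<in> S \<Longrightarrow> f i \<in> comm_ideal m) \<Longrightarrow> sum f S \<in> comm_ideal m"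
  by (induction S rule: infinite_finite_induct) (auto simp: comm_ideal_zero comm_ideal_add)

lemma scalar_comm_ideal_iff:
  assumes "c \<noteq> 0"
  shows "scalar c * f \<in> comm_ideal m \<longleftrightarrow> f \<in> comm_ideal m"
proof
  assume "scalar c * f \<in> comm_ideal m"
  then have "scalar (inverse c) * (scalar c * f) \<in> comm_ideal m" by (rule comm_ideal_left)
  with assms show "f \<in> comm_ideal m"
    by (simp add: scalar_1 flip: mult.assoc scalar_mult)
qed (rule comm_ideal_left)

lemma comm_span_subset_comm_ideal: "comm_span m \<subseteq> comm_ideal (Suc m)"
proof
  fix f :: "'n free_alg" assume "f \<in> comm_span m"
  then show "f \<in> comm_ideal (Suc m)"
  proof induction
    case (gen vs u)
    then show ?case
      unfolding comm_ideal_def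
      by (intro subsetD[OF ring.genideal_self[OF ring_free_ring]])
        (auto simp: ring_of_type_algebra_def)
  qed (rule comm_ideal_add)
qed

text \<open>The elements of the ideal with property \<open>P\<close> form an ideal again, so
  minimality of the generated ideal gives induction. Zero comes from \<open>gen\<close>, negatives
  from \<open>left\<close> with the factor \<open>- 1\<close>.\<close>

lemma comm_ideal_induct [consumes 1, case_names gen add left right]:
  fixes f :: "'n free_alg"
  assumes f: "f \<in> comm_ideal (Suc m)"
    and gen: "\<And>f. f \<in> comm_span m \<Longrightarrow> P f"
    and add: "\<And>f g. f \<in> comm_ideal (Suc m) \<Longrightarrow> g \<in> comm_ideal (Suc m) \<Longrightarrow> P f \<Longrightarrow> P g \<Longrightarrow> P (f + g)"
    and left: "\<And>f g. f \<in> comm_ideal (Suc m) \<Longrightarrow> P f \<Longrightarrow> P (g * f)"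
    and right: "\<And>f g. f \<in> comm_ideal (Suc m) \<Longrightarrow> P f \<Longrightarrow> P (f * g)"
  shows "P f"
proof -
  let ?I = "comm_ideal (Suc m) :: 'n free_alg set"
  let ?J = "{f \<in> ?I. P f}"
  interpret R: ring "free_ring :: 'n free_alg ring" by (rule ring_free_ring)
  have inv: "\<ominus>\<^bsub>free_ring\<^esub> g = - g" for g :: "'n free_alg"
    by (rule R.minus_equality) (simp_all add: ring_of_type_algebra_def)
  have "ideal ?J free_ring"
  proof (rule idealI[OF ring_free_ring])
    have "- g \<in> ?J" if "g \<in> ?J" for g
      using that left[of g "- 1"] by (simp add: comm_ideal_uminus)
    then show "subgroup ?J (add_monoid free_ring)"
      using gen[OF zero_in_comm_span]
      by (intro subgroup.intro)
        (auto simp: add comm_ideal_add comm_ideal_zero inv[unfolded a_inv_def]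
          ring_of_type_algebra_def inv[unfolded a_inv_def ring_of_type_algebra_def, simplified])
  qed (auto simp: ring_of_type_algebra_def left right comm_ideal_left comm_ideal_right)
  moreover have "{left_normed u vs | u vs. Suc (length vs) = Suc m} \<subseteq> ?J"
    using comm_span_subset_comm_ideal[of m] by (auto intro!: gen comm_span.gen)
  ultimately have "?I \<subseteq> ?J"
    unfolding comm_ideal_def[of "Suc m"] by (rule ring.genideal_minimal[OF ring_free_ring])
  with f show ?thesis by blast
qed

text \<open>Even when separated by left factors, \<open>q\<close> brackets amount to commutators of
  length \<open>q + 1\<close> times powers of \<open>x\<close>.\<close>

lemma nested_imp_comm_ideal:
  assumes "nested x q f"
  shows "f \<in> comm_ideal (Suc q)"
proof -
  from assms have "f \<in> comm_span_powers x q" by (rule nested_imp_comm_span_powers)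
  then show "f \<in> comm_ideal (Suc q)"
    by induction (use comm_span_subset_comm_ideal in \<open>auto simp: comm_ideal_right comm_ideal_add\<close>)
qed

lemma comm_ideal_derivation:
  assumes add: "\<And>f g. \<delta> (f + g) = \<delta> f + \<delta> g"
    and mult: "\<And>f g. \<delta> (f * g) = \<delta> f * g + f * \<delta> g"
    and "f \<in> comm_ideal (Suc m)"
  shows "\<delta> f \<in> comm_ideal (Suc m)"
  using assms(3)
proof (induction rule: comm_ideal_induct)
  case (gen f)
  have "\<delta> f \<in> comm_span m" by (rule comm_span_derivation[OF assms(1,2) gen])
  then show ?case using comm_span_subset_comm_ideal by blast
qed (simp_all add: add mult comm_ideal_add comm_ideal_left comm_ideal_right)


section \<open>Components of elements of the free algebra\<close>

lemma keys_mult_cases: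
  fixes f g :: "'n free_alg"
  assumes "w \<in> Poly_Mapping.keys (f * g)"
  obtains u v where "w = u @ v" "u \<in> Poly_Mapping.keys f" "v \<in> Poly_Mapping.keys g"
  using assms keys_mult[of f g] by (auto simp: plus_list_def)

lemma homogeneous_add: "f \<in> homogeneous i \<Longrightarrow> g \<in> homogeneous i \<Longrightarrow> f + g \<in> homogeneous i"
  using Poly_Mapping.keys_add[of f g] by (auto simp: homogeneous_def)

lemma zero_homogeneous: "0 \<in> homogeneous i"
  by (simp add: homogeneous_def)

lemma homogeneous_sum:
  "(\<And>k. k \<in> S \<Longrightarrow> f k \<in> homogeneous i) \<Longrightarrow> sum f S \<in> homogeneous i"
  by (induction S rule: infinite_finite_induct) (auto intro: homogeneous_add simp: zero_homogeneous)

lemma homogeneous_mult: "f \<in> homogeneous i \<Longrightarrow> g \<in> homogeneous j \<Longrightarrow> f * g \<in> homogeneous (i + j)"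
  by (auto simp: homogeneous_def elim!: keys_mult_cases)

lemma homogeneous_scalar: "scalar c \<in> homogeneous 0"
  by (simp add: homogeneous_def scalar_def)

lemma homogeneous_var: "var i \<in> homogeneous 1"
  by (simp add: homogeneous_def var_def)

lemma homogeneous_gl_act_single: "gl_act A (Poly_Mapping.single w c) \<in> homogeneous (length w)"
proof -
  have "linear_form v \<in> homogeneous 1" for v
    unfolding linear_form_def
    using homogeneous_mult[OF homogeneous_scalar homogeneous_var]
    by (intro homogeneous_sum) simp
  then have "prod_list (map (\<lambda>j. linear_form (column j A)) w) \<in> homogeneous (length w)"
    by (induction w) (use homogeneous_mult[of _ 1] homogeneous_scalar[of 1] in
        \<open>auto simp: scalar_1\<close>)
  then show ?thesis
    using homogeneous_mult[OF homogeneous_scalar] by (fastforce simp: gl_act_single)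
qed

lemma single_Cons: "Poly_Mapping.single (i # w) c = var i * Poly_Mapping.single w c"
  by (simp add: var_def mult_single plus_list_def)

lemma single_snoc: "Poly_Mapping.single (w @ [i]) c = Poly_Mapping.single w c * var i"
  by (simp add: var_def mult_single plus_list_def)

lemma single_Nil: "Poly_Mapping.single [] c = scalar c"
  by (simp add: scalar_def)

text \<open>A predicate on words serves all gradings at once: total degree with
  \<open>length w = d\<close>, multidegree with \<open>mset w = \<mu>\<close>.\<close>

definition restr :: "('n list \<Rightarrow> bool) \<Rightarrow> 'n free_alg \<Rightarrow> 'n free_alg" where
  "restr P f = (\<Sum>w\<in>Poly_Mapping.keys f. if P w then Poly_Mapping.single w (Poly_Mapping.lookup f w) else 0)"

lemma lookup_restr: "Poly_Mapping.lookup (restr P f) w = (if P w then Poly_Mapping.lookup f w else 0)"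
proof -
  have "Poly_Mapping.lookup (restr P f) w =
      (\<Sum>v\<in>Poly_Mapping.keys f. if v = w then (if P w then Poly_Mapping.lookup f w else 0) else 0)"
    unfolding restr_def lookup_sum by (rule sum.cong) (auto simp: lookup_single when_def)
  then show ?thesis by (simp add: in_keys_iff)
qed

lemma restr_True: "restr (\<lambda>w. True) f = f"
  by (rule poly_mapping_eqI) (simp add: lookup_restr)

lemma restr_False: "restr (\<lambda>w. False) f = 0"
  by (rule poly_mapping_eqI) (simp add: lookup_restr)

lemma keys_restr: "Poly_Mapping.keys (restr P f) = {w \<in> Poly_Mapping.keys f. P w}"
  by (auto simp: in_keys_iff lookup_restr split: if_splits)

lemma restr_add: "restr P (f + g) = restr P f + restr P g"
  by (rule poly_mapping_eqI) (simp add: lookup_restr lookup_add)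

lemma restr_diff: "restr P (f - g) = restr P f - restr P g"
  by (rule poly_mapping_eqI) (simp add: lookup_restr lookup_minus)

lemma restr_single: "restr P (Poly_Mapping.single w c) = (if P w then Poly_Mapping.single w c else 0)"
  by (rule poly_mapping_eqI) (auto simp: lookup_restr lookup_single when_def)

lemma restr_id: "(\<And>w. w \<in> Poly_Mapping.keys f \<Longrightarrow> P w) \<Longrightarrow> restr P f = f"
  by (rule poly_mapping_eqI) (auto simp: lookup_restr in_keys_iff)

lemma restr_eq_0: "(\<And>w. w \<in> Poly_Mapping.keys f \<Longrightarrow> \<not> P w) \<Longrightarrow> restr P f = 0"
  by (rule poly_mapping_eqI) (auto simp: lookup_restr in_keys_iff)

lemma restr_single_mult:
  "restr P (Poly_Mapping.single v c * f) = Poly_Mapping.single v c * restr (\<lambda>w. P (v @ w)) f"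
  by (induction f rule: free_alg_induct)
    (simp_all add: restr_add distrib_left mult_single restr_single plus_list_def)

lemma restr_mult_single:
  "restr P (f * Poly_Mapping.single v c) = restr (\<lambda>w. P (w @ v)) f * Poly_Mapping.single v c"
  by (induction f rule: free_alg_induct)
    (simp_all add: restr_add distrib_right mult_single restr_single plus_list_def)

lemma sum_restr:
  "(\<Sum>k\<in>\<gamma> ` Poly_Mapping.keys f. restr (\<lambda>w. \<gamma> w = k) f) = f"
  by (rule poly_mapping_eqI) (auto simp: lookup_sum lookup_restr in_keys_iff)

lemma sum_single_lookup:
  fixes f :: "'n free_alg"
  shows "(\<Sum>w\<in>Poly_Mapping.keys f. Poly_Mapping.single w (Poly_Mapping.lookup f w)) = f"
  using restr_True[of f] by (simp add: restr_def)

lemma restr_gl_act: "restr (\<lambda>w. length w = d) (gl_act A f) = gl_act A (restr (\<lambda>w. length w = d) f)"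
proof (induction f rule: free_alg_induct)
  case (single w c)
  then show ?case
    using homogeneous_gl_act_single[of A w c]
    by (auto simp: restr_single homogeneous_def intro: restr_id restr_eq_0)
next
  case (sum f g)
  then show ?case by (simp add: restr_add gl_act_add)
qed

section \<open>Homogeneity of the ideal for a grading of the words\<close>

context
  fixes \<gamma> :: "'n list \<Rightarrow> 'g::cancel_comm_monoid_add"
  assumes \<gamma>_append: "\<gamma> (v @ w) = \<gamma> v + \<gamma> w"
begin

text \<open>Multiplication by \<open>v\<close> shifts degrees by \<open>\<gamma> v\<close>. By
  cancellation a single degree \<open>k'\<close>, or none, is shifted to \<open>k\<close>; by
  commutativity it is the same on both sides, as commutators require.\<close>

lemma restr_grading_cases:
  obtains k' where "(\<lambda>w. \<gamma> (v @ w) = k) = (\<lambda>w. \<gamma> w = k')" "(\<lambda>w. \<gamma> (w @ v) = k) = (\<lambda>w. \<gamma> w = k')"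
  | "(\<lambda>w. \<gamma> (v @ w) = k) = (\<lambda>w. False)" "(\<lambda>w. \<gamma> (w @ v) = k) = (\<lambda>w. False)"
proof (cases "\<exists>k'. k = \<gamma> v + k'")
  case True
  then obtain k' where "k = \<gamma> v + k'" by blast
  then show ?thesis by (intro that(1)[of k']) (auto simp: \<gamma>_append add.commute)
next
  case False
  then show ?thesis by (intro that(2)) (auto simp: \<gamma>_append fun_eq_iff add.commute)
qed

text \<open>For a multiple \<open>g\<close> of a word, a component of \<open>[f, g]\<close> is zero
  or the bracket of some component of \<open>f\<close> with \<open>g\<close>; additivity in
  \<open>g\<close> does the rest.\<close>

lemma restr_comm_span_commutator:
  assumes "\<And>k. restr (\<lambda>w. \<gamma> w = k) f \<in> comm_span m"
  shows "restr (\<lambda>w. \<gamma> w = k) (commutator f g) \<in> comm_span (Suc m)"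
proof (induction g rule: free_alg_induct)
  case (single v c)
  show ?case
    by (rule restr_grading_cases[of v k])
      (use comm_span_commutator[OF assms] in \<open>simp_all add: commutator_def restr_diff
        restr_single_mult restr_mult_single restr_False zero_in_comm_span\<close>)
next
  case (sum g h)
  have "commutator f (g + h) = commutator f g + commutator f h"
    by (simp add: commutator_def algebra_simps)
  with sum show ?case by (simp add: restr_add comm_span.add)
qed

lemma restr_comm_span: "f \<in> comm_span m \<Longrightarrow> restr (\<lambda>w. \<gamma> w = k) f \<in> comm_span m"
proof (induction arbitrary: k rule: comm_span.induct)
  case (gen vs u)
  then show ?case
  proof (induction vs arbitrary: m k rule: rev_induct)
    case Nil
    then show ?case by (simp add: comm_span_0)
  next
    case (snoc v vs)
    then show ?case by (auto simp: left_normed_snoc intro!: restr_comm_span_commutator)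
  qed
next
  case (add f g)
  then show ?case by (simp add: restr_add comm_span.add)
qed

text \<open>The spans of commutators are graded, and multiplication by a word carries components to
  components.\<close>

lemma restr_comm_ideal:
  "f \<in> comm_ideal (Suc m) \<Longrightarrow> restr (\<lambda>w. \<gamma> w = k) f \<in> comm_ideal (Suc m)"
proof (induction arbitrary: k rule: comm_ideal_induct)
  case (gen f)
  then show ?case using restr_comm_span comm_span_subset_comm_ideal by blast
next
  case (left f g)
  show ?case
  proof (induction g rule: free_alg_induct)
    case (single v c)
    show ?case
      by (rule restr_grading_cases[of v k])
        (simp_all add: restr_single_mult left.IH comm_ideal_left restr_False comm_ideal_zero)
  qed (simp add: distrib_right restr_add comm_ideal_add)
next
  case (right f g)
  show ?case
  proof (induction g rule: free_alg_induct)
    case (single v c)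
    show ?case
      by (rule restr_grading_cases[of v k])
        (simp_all add: restr_mult_single right.IH comm_ideal_right restr_False comm_ideal_zero)
  qed (simp add: distrib_left restr_add comm_ideal_add)
qed (simp add: restr_add comm_ideal_add)

end


section \<open>Extracting a variable of large degree\<close>

text \<open>The word is read from left to right. With \<open>x = var i\<close>, appending
  \<open>i\<close> to \<open>x g + h\<close> gives \<open>x (g x + h) + [h, x]\<close>, so the
  remainder gains a bracket; appending another letter keeps its depth.\<close>

lemma single_split_var:
  "\<exists>g h. Poly_Mapping.single w c = var i * g + h \<and> nested (var i) (count (mset w) i) h"
proof (induction w rule: rev_induct)
  case Nil
  show ?case by (rule exI[of _ 0]) (simp add: nested.base)
next
  case (snoc j w)
  then obtain g h where gh: "Poly_Mapping.single w c = var i * g + h"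
    "nested (var i) (count (mset w) i) h" by blast
  show ?case
  proof (cases "j = i")
    case True
    have "Poly_Mapping.single (w @ [j]) c = var i * (g * var i + h) + 1 * commutator h (var i)"
      by (simp add: True single_snoc gh(1) commutator_def algebra_simps)
    then show ?thesis using nested.step[OF gh(2), of 1] True by auto
  next
    case False
    have "Poly_Mapping.single (w @ [j]) c = var i * (g * var j) + h * var j"
      by (simp add: single_snoc gh(1) algebra_simps)
    then show ?thesis using nested_right_mult[OF gh(2), of "var j"] False by auto
  qed
qed

text \<open>Each word leaves a remainder with at least \<open>p\<close> brackets against
  \<open>var i\<close>, hence in the ideal; the cofactors are added up.\<close>

lemma split_var:
  assumes "\<And>w. w \<in> Poly_Mapping.keys f \<Longrightarrow> p \<le> count (mset w) i"
  shows "\<exists>g. f - var i * g \<in> comm_ideal (Suc p)"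
proof -
  have antimono: "nested (var i) (q + k) h \<Longrightarrow> nested (var i) q h" for q k h
    by (induction k) (auto dest: nested_Suc_imp)
  have "\<exists>g. Poly_Mapping.single w (Poly_Mapping.lookup f w) - var i * g \<in> comm_ideal (Suc p)"
    if w: "w \<in> Poly_Mapping.keys f" for w
  proof -
    obtain g h where "Poly_Mapping.single w (Poly_Mapping.lookup f w) = var i * g + h"
      and "nested (var i) (count (mset w) i) h"
      using single_split_var[of w "Poly_Mapping.lookup f w" i] by blast
    moreover from this(2) have "nested (var i) p h"
      using antimono[of p "count (mset w) i - p"] assms[OF w] by simp
    ultimately show ?thesis by (intro exI[of _ g]) (simp add: nested_imp_comm_ideal)
  qed
  then obtain g where g: "\<And>w. w \<in> Poly_Mapping.keys f \<Longrightarrow>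
      Poly_Mapping.single w (Poly_Mapping.lookup f w) - var i * g w \<in> comm_ideal (Suc p)"
    by metis
  have "(\<Sum>w\<in>Poly_Mapping.keys f. Poly_Mapping.single w (Poly_Mapping.lookup f w) - var i * g w)
      \<in> comm_ideal (Suc p)" by (rule comm_ideal_sum) (rule g)
  then have "f - var i * (\<Sum>w\<in>Poly_Mapping.keys f. g w) \<in> comm_ideal (Suc p)"
    by (simp add: sum_subtractf sum_single_lookup sum_distrib_left)
  then show ?thesis by blast
qed


section \<open>Derivations of the free algebra\<close>

text \<open>Its linear extension \<open>der d\<close> is the unique derivation that vanishes on
  scalars and sends each \<open>var i\<close> to \<open>d i\<close>.\<close>

primrec der_word :: "('n \<Rightarrow> 'n free_alg) \<Rightarrow> 'n list \<Rightarrow> 'n free_alg" where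
  "der_word d [] = 0"
| "der_word d (i # w) = d i * Poly_Mapping.single w 1 + var i * der_word d w"

definition der :: "('n \<Rightarrow> 'n free_alg) \<Rightarrow> 'n free_alg \<Rightarrow> 'n free_alg" where
  "der d f = (\<Sum>w\<in>Poly_Mapping.keys f. scalar (Poly_Mapping.lookup f w) * der_word d w)"

lemma der_superset:
  assumes "finite W" "Poly_Mapping.keys f \<subseteq> W"
  shows "der d f = (\<Sum>w\<in>W. scalar (Poly_Mapping.lookup f w) * der_word d w)"
  unfolding der_def
  by (rule sum.mono_neutral_left) (use assms in \<open>auto simp: in_keys_iff scalar_0\<close>)

lemma der_add: "der d (f + g) = der d f + der d g"
proof -
  let ?W = "Poly_Mapping.keys f \<union> Poly_Mapping.keys g"
  have "finite ?W" by simp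
  note * = der_superset[OF this]
  show ?thesis
    by (subst (1 2 3) *) (use Poly_Mapping.keys_add[of f g] in
      \<open>auto simp: lookup_add scalar_add distrib_right sum.distrib\<close>)
qed

lemma der_single: "der d (Poly_Mapping.single w c) = scalar c * der_word d w"
  by (simp add: der_def scalar_0)

lemma der_0: "der d 0 = 0"
  by (simp add: der_def)

lemma der_uminus: "der d (- f) = - der d f"
  using der_add[of d "- f" f] by (simp add: eq_neg_iff_add_eq_0 der_0)

lemma der_diff: "der d (f - g) = der d f - der d g"
  using der_add[of d f "- g"] by (simp add: der_uminus)

lemma der_scalar: "der d (scalar c) = 0"
  by (simp add: scalar_def der_single)

lemma der_var: "der d (var i) = d i"
  by (simp add: var_def der_single scalar_1 single_Nil)

lemma der_word_append:
  "der_word d (v @ w) = der_word d v * Poly_Mapping.single w 1 + Poly_Mapping.single v 1 * der_word d w"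
proof (induction v)
  case Nil
  show ?case by (simp add: single_Nil scalar_1)
next
  case (Cons i v)
  have "Poly_Mapping.single (v @ w) (1 :: complex) = Poly_Mapping.single v 1 * Poly_Mapping.single w 1"
    by (simp add: mult_single plus_list_def)
  then show ?case by (simp add: Cons single_Cons distrib_left distrib_right mult.assoc add.assoc)
qed

lemma single_scalar: "Poly_Mapping.single w c = scalar c * Poly_Mapping.single w 1"
  by (simp add: scalar_def mult_single plus_list_def)

lemma scalar_left_commute: "f * (scalar c * g) = scalar c * (f * g)"
  by (metis mult.assoc scalar_commute)

lemma der_mult: "der d (f * g) = der d f * g + f * der d g"
proof (induction f rule: free_alg_induct)
  case (single v a)
  show ?case
  proof (induction g rule: free_alg_induct)
    case (single w b)
    let ?v = "Poly_Mapping.single v 1 :: 'a free_alg" and ?w = "Poly_Mapping.single w 1 :: 'a free_alg"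
    have "scalar a * der_word d v * Poly_Mapping.single w b = scalar (a * b) * (der_word d v * ?w)"
      by (subst single_scalar[of w b])
        (simp add: scalar_mult mult.assoc scalar_left_commute[of "der_word d v"])
    moreover have "Poly_Mapping.single v a * (scalar b * der_word d w) = scalar (a * b) * (?v * der_word d w)"
      by (subst single_scalar[of v a]) (simp add: scalar_mult mult.assoc scalar_left_commute[of ?v])
    ultimately show ?case
      by (simp add: mult_single plus_list_def der_single der_word_append distrib_left)
  qed (simp add: distrib_left der_add)
qed (simp add: distrib_right der_add)

lemma der_scalar_mult: "der d (scalar c * f) = scalar c * der d f"
  by (simp add: der_mult der_scalar)

text \<open>Words are products of variables, so the Leibniz rule leaves no freedom. Identities
  between derivations are thereby reduced to their values on variables.\<close>

lemma der_eqI: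
  assumes add: "\<And>f g. \<delta> (f + g) = \<delta> f + \<delta> g"
    and mult: "\<And>f g. \<delta> (f * g) = \<delta> f * g + f * \<delta> g"
    and scalar: "\<And>c. \<delta> (scalar c) = 0"
  shows "\<delta> f = der (\<lambda>i. \<delta> (var i)) f"
proof (induction f rule: free_alg_induct)
  case (single w c)
  show ?case
  proof (induction w)
    case Nil
    show ?case by (simp add: single_Nil scalar der_scalar)
  next
    case (Cons i w)
    then show ?case by (simp add: single_Cons mult der_mult der_var)
  qed
qed (simp add: add der_add)

text \<open>The mixed terms cancel, so the commutator of two derivations is a derivation and is
  determined by its values on variables.\<close>

lemma der_commutator:
  "der d (der e f) - der e (der d f) = der (\<lambda>i. der d (e i) - der e (d i)) f"
  using der_eqI[of "\<lambda>f. der d (der e f) - der e (der d f)" f]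
  by (simp add: der_add der_mult der_scalar der_0 der_var algebra_simps)

lemma der_comm_ideal: "f \<in> comm_ideal (Suc m) \<Longrightarrow> der d f \<in> comm_ideal (Suc m)"
  by (rule comm_ideal_derivation) (simp_all add: der_add der_mult)

text \<open>A weighted Euler operator: each letter \<open>i\<close> of a word contributes
  \<open>c i\<close> to the eigenvalue.\<close>

lemma der_diagonal:
  assumes "\<And>w. w \<in> Poly_Mapping.keys f \<Longrightarrow> sum_list (map c w) = s"
  shows "der (\<lambda>i. scalar (c i) * var i) f = scalar s * f"
proof -
  have "der_word (\<lambda>i. scalar (c i) * var i) w = scalar (sum_list (map c w)) * Poly_Mapping.single w 1" for w
  proof (induction w)
    case Nil
    show ?case by (simp add: scalar_0)
  next
    case (Cons i w)
    then show ?case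
      by (simp add: single_Cons scalar_add distrib_right mult.assoc scalar_left_commute[of "var i"])
  qed
  then have "der (\<lambda>i. scalar (c i) * var i) f
      = (\<Sum>w\<in>Poly_Mapping.keys f. scalar s * Poly_Mapping.single w (Poly_Mapping.lookup f w))"
    unfolding der_def
    by (intro sum.cong)
      (simp_all add: assms scalar_def mult_single plus_list_def mult.commute[of "Poly_Mapping.lookup _ _"])
  then show ?thesis by (simp add: sum_single_lookup flip: sum_distrib_left)
qed

lemma keys_der:
  assumes "v \<in> Poly_Mapping.keys (der d f)"
  obtains w where "w \<in> Poly_Mapping.keys f" "v \<in> Poly_Mapping.keys (der_word d w)"
proof -
  from assms have "v \<in> (\<Union>w\<in>Poly_Mapping.keys f.
      Poly_Mapping.keys (scalar (Poly_Mapping.lookup f w) * der_word d w))"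
    unfolding der_def by (rule subsetD[OF Poly_Mapping.keys_sum])
  then obtain w where w: "w \<in> Poly_Mapping.keys f"
    and "v \<in> Poly_Mapping.keys (scalar (Poly_Mapping.lookup f w) * der_word d w)" by blast
  from this(2) have "v \<in> Poly_Mapping.keys (der_word d w)"
    by (rule keys_mult_cases) (auto simp: scalar_def split: if_splits)
  with w show ?thesis by (rule that)
qed

lemma keys_der_word:
  assumes "v \<in> Poly_Mapping.keys (der_word d w)"
  obtains w1 i u w2 where "w = w1 @ i # w2" "v = w1 @ u @ w2" "u \<in> Poly_Mapping.keys (d i)"
  using assms
proof (induction w arbitrary: v thesis)
  case (Cons i w)
  from Cons.prems(2) consider "v \<in> Poly_Mapping.keys (d i * Poly_Mapping.single w 1)"
    | "v \<in> Poly_Mapping.keys (var i * der_word d w)"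
    using Poly_Mapping.keys_add by fastforce
  then show ?case
  proof cases
    case 1
    then obtain u where "v = u @ w" "u \<in> Poly_Mapping.keys (d i)"
      by (rule keys_mult_cases) auto
    then show ?thesis using Cons.prems(1)[of "[]" i w u] by simp
  next
    case 2
    then obtain v' where v': "v = i # v'" "v' \<in> Poly_Mapping.keys (der_word d w)"
      by (rule keys_mult_cases) (auto simp: var_def)
    from Cons.IH[OF _ v'(2)] obtain w1 k u w2
      where "w = w1 @ k # w2" "v' = w1 @ u @ w2" "u \<in> Poly_Mapping.keys (d k)" by blast
    then show ?thesis using Cons.prems(1)[of "i # w1" k w2 u] v'(1) by simp
  qed
qed simp

text \<open>Each application replaces one letter \<open>i\<close> by a word without
  \<open>i\<close>, so the number of letters \<open>i\<close> drops by exactly one.\<close>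

lemma der_funpow_eq_0:
  assumes d: "\<And>j. j \<noteq> i \<Longrightarrow> d j = 0"
    and di: "\<And>u. u \<in> Poly_Mapping.keys (d i) \<Longrightarrow> i \<notin> set u"
    and "\<And>w. w \<in> Poly_Mapping.keys f \<Longrightarrow> count (mset w) i < k"
  shows "(der d ^^ k) f = 0"
  using assms(3)
proof (induction k arbitrary: f)
  case 0
  then have "Poly_Mapping.keys f = {}" by (metis equals0I not_less0)
  then show ?case by simp
next
  case (Suc k)
  have "(der d ^^ k) (der d f) = 0"
  proof (rule Suc.IH)
    fix v assume "v \<in> Poly_Mapping.keys (der d f)"
    then obtain w where w: "w \<in> Poly_Mapping.keys f" "v \<in> Poly_Mapping.keys (der_word d w)"
      by (rule keys_der)
    from w(2) obtain w1 j u w2 where *: "w = w1 @ j # w2" "v = w1 @ u @ w2" "u \<in> Poly_Mapping.keys (d j)"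
      by (rule keys_der_word)
    have "j = i"
    proof (rule ccontr)
      assume "j \<noteq> i"
      from d[OF this] *(3) show False by simp
    qed
    moreover from this di *(3) have "count (mset u) i = 0"
      by (metis count_eq_zero_iff set_mset_mset)
    ultimately have "count (mset w) i = Suc (count (mset v) i)" using *(1,2) by simp
    with Suc.prems[OF w(1)] show "count (mset v) i < k" by simp
  qed
  moreover have "(der d ^^ Suc k) f = (der d ^^ k) (der d f)"
    by (simp add: funpow_Suc_right del: funpow.simps)
  ultimately show ?case by (rule trans[rotated])
qed

lemma der_funpow_comm_ideal: "f \<in> comm_ideal (Suc m) \<Longrightarrow> (der d ^^ k) f \<in> comm_ideal (Suc m)"
proof (induction k)
  case (Suc k)
  then show ?case by (simp add: der_comm_ideal)
qed simp

text \<open>For the partial derivative \<open>D\<close> in \<open>x = var i\<close>,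
  \<open>D^(k+1) (x f) = x D^(k+1) f + (k + 1) D^k f\<close>. Since \<open>D\<close> preserves the
  ideal and is nilpotent on \<open>f\<close>, and \<open>k + 1\<close> is invertible, one descends
  from \<open>D^N f = 0\<close> to \<open>f\<close>.\<close>

lemma var_mult_comm_ideal:
  assumes "var i * f \<in> comm_ideal (Suc m)"
  shows "f \<in> comm_ideal (Suc m)"
proof -
  define D where "D = der (\<lambda>j. if j = i then 1 else 0)"
  \<comment> \<open>\<open>N\<close> exceeds the degree in \<open>var i\<close> of every word of
    \<open>f\<close>; \<open>insert 0\<close> keeps \<open>Max\<close> meaningful for
    \<open>f = 0\<close>.\<close>
  define N where "N = Suc (Max (insert 0 ((\<lambda>w. count (mset w) i) ` Poly_Mapping.keys f)))"
  have leibniz: "(D ^^ Suc k) (var i * f) = var i * (D ^^ Suc k) f + scalar (of_nat (Suc k)) * (D ^^ k) f" for k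
  proof (induction k)
    case 0
    show ?case by (simp add: D_def der_mult der_var scalar_1)
  next
    case (Suc k)
    have 1: "scalar (of_nat (Suc (Suc k))) = 1 + scalar (of_nat (Suc k))"
      unfolding of_nat_Suc[of "Suc k"] by (simp only: scalar_add scalar_1)
    have 2: "D (var i * D g + scalar c * g) = var i * D (D g) + (1 + scalar c) * D g" for g c
      by (simp add: D_def der_add der_mult der_var der_scalar distrib_right)
    from Suc.IH show ?case by (simp only: 1 2 funpow.simps o_apply)
  qed
  have "(D ^^ N) f = 0"
    unfolding D_def
  proof (rule der_funpow_eq_0[of i])
    fix w assume "w \<in> Poly_Mapping.keys f"
    then show "count (mset w) i < N"
      unfolding N_def less_Suc_eq_le by (intro Max_ge) auto
  qed (auto simp: zero_list_def)
  then have "(D ^^ N) f \<in> comm_ideal (Suc m)" by (simp add: comm_ideal_zero)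
  then show ?thesis
  proof (induction N)
    case (Suc k)
    have "(D ^^ Suc k) (var i * f) \<in> comm_ideal (Suc m)"
      unfolding D_def by (rule der_funpow_comm_ideal[OF assms])
    from comm_ideal_diff[OF this comm_ideal_left[OF Suc.prems, of "var i"]]
    have "scalar (of_nat (Suc k)) * (D ^^ k) f \<in> comm_ideal (Suc m)"
      by (simp only: leibniz add_diff_cancel_left')
    moreover have "of_nat (Suc k) \<noteq> (0 :: complex)" by (rule of_nat_neq_0)
    ultimately have "(D ^^ k) f \<in> comm_ideal (Suc m)" using scalar_comm_ideal_iff by blast
    then show ?case by (rule Suc.IH)
  qed simp
qed


section \<open>Weights and raising operators\<close>

lemma scalar_uminus: "scalar (- c) = - scalar c"
  by (simp add: scalar_def single_uminus)

lemma scalar_diff: "scalar (a - b) = scalar a - scalar b"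
  by (simp add: scalar_def single_diff)

lemma der_scale: "der (\<lambda>i. scalar c * d i) f = scalar c * der d f"
proof -
  have "scalar c * der d (g * h) = scalar c * der d g * h + g * (scalar c * der d h)" for g h
    by (simp add: der_mult distrib_left scalar_left_commute[of g] mult.assoc)
  then have "scalar c * der d f = der (\<lambda>i. scalar c * der d (var i)) f"
    by (intro der_eqI) (simp_all add: der_add der_scalar distrib_left)
  then show ?thesis by (simp add: der_var)
qed

text \<open>
  In the \<open>\<ss>\<ll>\<^sub>2\<close>-action on the variables \<open>x\<^sub>m\<close> and \<open>x\<^sub>j\<close>, the raising operator is injective on
  negative weights, because \<open>E F\<^sup>k\<^sup>+\<^sup>1 f\<close> is a nonzero multiple of \<open>F\<^sup>k f\<close> when \<open>E f = 0\<close>,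
  and \<open>F\<close> is nilpotent.
\<close>

lemma raising_injective:
  fixes f :: "'n free_alg"
  assumes mj: "m \<noteq> j"
    and weight: "\<And>w. w \<in> Poly_Mapping.keys f \<Longrightarrow> count (mset w) m = a \<and> count (mset w) j = b"
    and ab: "a < b"
    and E: "der (\<lambda>i. if i = j then var m else 0) f \<in> comm_ideal (Suc q)"
  shows "f \<in> comm_ideal (Suc q)"
proof -
  \<comment> \<open>With these eigenvalues \<open>H\<close> is the commutator of \<open>E\<close>
    and \<open>F\<close>, which gives an sl2-triple; \<open>s\<close> is the weight of
    \<open>f\<close>.\<close>
  define c :: "'n \<Rightarrow> complex" where "c i = (if i = m then 1 else if i = j then - 1 else 0)" for i
  define E where "E = der (\<lambda>i. if i = j then var m else 0)"
  define F where "F = der (\<lambda>i. if i = m then var j else 0)"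
  define H where "H = der (\<lambda>i. scalar (c i) * var i)"
  define s :: complex where "s = of_nat a - of_nat b"
  have F_ideal: "g \<in> comm_ideal (Suc q) \<Longrightarrow> F g \<in> comm_ideal (Suc q)" for g
    unfolding F_def by (rule der_comm_ideal)
  have sum_c: "sum_list (map c w) = of_nat (count (mset w) m) - of_nat (count (mset w) j)" for w
    using mj by (induction w) (auto simp: c_def)
  have Hf: "H f = scalar s * f"
    unfolding H_def by (rule der_diagonal) (simp add: sum_c weight s_def)
  have EF: "E (F g) = F (E g) + H g" for g
  proof -
    have "E (F g) - F (E g) = der (\<lambda>i. scalar (c i) * var i) g"
      unfolding E_def F_def der_commutator
      by (rule arg_cong[of _ _ "\<lambda>d. der d g"], rule ext)
        (use mj in \<open>auto simp: der_var der_0 c_def scalar_0 scalar_1 scalar_uminus\<close>)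
    then show ?thesis by (simp add: H_def algebra_simps)
  qed
  have two: "scalar 2 * var j = var j + var j"
  proof -
    have "scalar 2 * var j = scalar (1 + 1) * var j" by simp
    also have "\<dots> = var j + var j" by (simp only: scalar_add scalar_1 distrib_right mult_1_left)
    finally show ?thesis .
  qed
  have HF: "H (F g) = F (H g) - scalar 2 * F g" for g
  proof -
    have "H (F g) - F (H g) = der (\<lambda>i. scalar (- 2) * (if i = m then var j else 0)) g"
      unfolding H_def F_def der_commutator
      by (rule arg_cong[of _ _ "\<lambda>d. der d g"], rule ext)
        (use mj in \<open>auto simp: der_var der_0 der_scalar_mult c_def scalar_0 scalar_1
          scalar_uminus two\<close>)
    also have "\<dots> = - (scalar 2 * F g)" unfolding der_scale F_def by (simp add: scalar_uminus)
    finally show ?thesis by (simp add: algebra_simps)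
  qed
  have F_scalar: "F (scalar u * g) = scalar u * F g" for u g
    unfolding F_def by (rule der_scalar_mult)
  have HFk: "H ((F ^^ k) f) = scalar (s - 2 * of_nat k) * (F ^^ k) f" for k
  proof (induction k)
    case 0
    show ?case by (simp add: Hf)
  next
    case (Suc k)
    have "H ((F ^^ Suc k) f) = F (H ((F ^^ k) f)) - scalar 2 * F ((F ^^ k) f)"
      by (simp add: HF)
    also have "\<dots> = (scalar (s - 2 * of_nat k) - scalar 2) * (F ^^ Suc k) f"
      unfolding Suc.IH F_scalar by (simp add: left_diff_distrib)
    also have "scalar (s - 2 * of_nat k) - scalar 2 = (scalar (s - 2 * of_nat (Suc k)) :: 'n free_alg)"
      by (simp add: algebra_simps flip: scalar_diff)
    finally show ?case .
  qed
  \<comment> \<open>The identity \<open>(k+2)(s-k-1) = (k+1)(s-k) + (s-2(k+1))\<close> drives the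
    induction, its last term coming from \<open>H\<close>. Only a congruence results, since
    \<open>E f\<close> is merely known to lie in the ideal.\<close>
  have EFk: "E ((F ^^ Suc k) f) - scalar (of_nat (Suc k) * (s - of_nat k)) * (F ^^ k) f
      \<in> comm_ideal (Suc q)" for k
  proof (induction k)
    case 0
    have "E ((F ^^ Suc 0) f) - scalar (of_nat (Suc 0) * (s - of_nat 0)) * (F ^^ 0) f = F (E f)"
      by (simp add: EF Hf)
    then show ?case using F_ideal[OF E] by (simp add: E_def)
  next
    case (Suc k)
    let ?g = "(F ^^ Suc k) f"
    let ?c = "of_nat (Suc k) * (s - of_nat k)"
    have c: "of_nat (Suc (Suc k)) * (s - of_nat (Suc k)) = ?c + (s - 2 * of_nat (Suc k))"
      by (simp add: algebra_simps)
    have "E ((F ^^ Suc (Suc k)) f) = F (E ?g) + scalar (s - 2 * of_nat (Suc k)) * ?g"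
      using EF[of ?g] HFk[of "Suc k"] by simp
    then have "E ((F ^^ Suc (Suc k)) f) - scalar (of_nat (Suc (Suc k)) * (s - of_nat (Suc k))) * ?g
        = F (E ?g) - scalar ?c * ?g"
      unfolding c scalar_add distrib_right by simp
    also have "\<dots> = F (E ?g - scalar ?c * (F ^^ k) f)"
    proof -
      have "F (g - h) = F g - F h" for g h unfolding F_def by (rule der_diff)
      then show ?thesis by (simp only: F_scalar funpow.simps o_apply)
    qed
    finally show ?case using F_ideal[OF Suc.IH] by (simp only:)
  qed
  \<comment> \<open>\<open>F\<close> trades a letter \<open>m\<close> for a letter \<open>j\<close>,
    and every word has exactly \<open>a\<close> letters \<open>m\<close>.\<close>
  have "(F ^^ Suc a) f = 0"
    unfolding F_def
  proof (rule der_funpow_eq_0[of m])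
    show "m \<notin> set u" if "u \<in> Poly_Mapping.keys (if m = m then var j else 0)" for u
      using that mj by (auto simp: var_def)
  qed (use weight in auto)
  then have "(F ^^ Suc a) f \<in> comm_ideal (Suc q)" by (simp only: comm_ideal_zero)
  moreover have "(F ^^ k) f \<in> comm_ideal (Suc q)" if "(F ^^ Suc k) f \<in> comm_ideal (Suc q)" for k
  proof -
    have "E ((F ^^ Suc k) f) \<in> comm_ideal (Suc q)"
      unfolding E_def using that by (rule der_comm_ideal)
    from comm_ideal_diff[OF this EFk[of k]]
    have "scalar (of_nat (Suc k) * (s - of_nat k)) * (F ^^ k) f \<in> comm_ideal (Suc q)"
      by (simp only: diff_diff_eq2 add_diff_cancel_left')
    moreover have "of_nat (Suc k) * (s - of_nat k) \<noteq> 0"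
    proof -
      \<comment> \<open>Negativity of the weight \<open>s = a - b\<close> excludes
        \<open>s = k\<close>.\<close>
      have "of_nat a \<noteq> (of_nat (b + k) :: complex)" using ab unfolding of_nat_eq_iff by simp
      then have "s - of_nat k \<noteq> 0" by (simp add: s_def algebra_simps)
      moreover have "of_nat (Suc k) \<noteq> (0 :: complex)" by (rule of_nat_neq_0)
      ultimately show ?thesis by (simp only: mult_eq_0_iff de_Morgan_disj simp_thms)
    qed
    ultimately show ?thesis using scalar_comm_ideal_iff by blast
  qed
  \<comment> \<open>Descent from the exponent \<open>a + 1\<close> to \<open>0\<close>.\<close>
  ultimately have "(F ^^ 0) f \<in> comm_ideal (Suc q)"
    by (induction "Suc a" arbitrary: a) (metis not0_implies_Suc)+
  then show ?thesis by simp
qed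

text \<open>A Vandermonde argument by induction: replacing \<open>t\<close> by \<open>2t\<close> and
  subtracting \<open>2^(N+1)\<close> times the original cancels the top coefficient and multiplies
  the \<open>k\<close>-th one by \<open>2^k - 2^(N+1)\<close>, which is nonzero.\<close>

lemma polynomial_coeffs_comm_ideal:
  assumes "\<And>t. (\<Sum>k\<le>N. scalar (t ^ k) * c k) \<in> comm_ideal q" "k \<le> N"
  shows "c k \<in> comm_ideal q"
  using assms
proof (induction N arbitrary: c k)
  case 0
  show ?case using "0.prems"(1)[of 1] "0.prems"(2) by (simp add: scalar_1)
next
  case (Suc N)
  define u :: "nat \<Rightarrow> complex" where "u k = 2 ^ k - 2 ^ Suc N" for k
  have low: "c k \<in> comm_ideal q" if "k \<le> N" for k
  proof -
    have "scalar (u k) * c k \<in> comm_ideal q"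
    proof (rule Suc.IH[OF _ that])
      fix t :: complex
      have "scalar (t ^ k) * (scalar (u k) * c k)
          = scalar ((2 * t) ^ k) * c k - scalar (2 ^ Suc N) * (scalar (t ^ k) * c k)" for k
      proof -
        have "t ^ k * u k = (2 * t) ^ k - 2 ^ Suc N * t ^ k"
          by (simp add: u_def power_mult_distrib algebra_simps)
        then have "scalar (t ^ k * u k) = scalar ((2 * t) ^ k) - (scalar (2 ^ Suc N * t ^ k) :: 'a free_alg)"
          by (simp only: scalar_diff)
        then show ?thesis by (simp only: scalar_mult mult.assoc[symmetric] left_diff_distrib)
      qed
      then have "(\<Sum>k\<le>N. scalar (t ^ k) * (scalar (u k) * c k))
          = (\<Sum>k\<le>N. scalar ((2 * t) ^ k) * c k) - scalar (2 ^ Suc N) * (\<Sum>k\<le>N. scalar (t ^ k) * c k)"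
        by (simp only: sum_subtractf sum_distrib_left)
      also have "\<dots> = (\<Sum>k\<le>Suc N. scalar ((2 * t) ^ k) * c k)
          - scalar (2 ^ Suc N) * (\<Sum>k\<le>Suc N. scalar (t ^ k) * c k)"
        by (simp add: distrib_left power_mult_distrib scalar_mult mult.assoc)
      finally show "(\<Sum>k\<le>N. scalar (t ^ k) * (scalar (u k) * c k)) \<in> comm_ideal q"
        by (simp only: comm_ideal_diff[OF Suc.prems(1) comm_ideal_left[OF Suc.prems(1)]])
    qed
    moreover have "u k \<noteq> 0"
    proof -
      have "(2 :: nat) ^ k \<noteq> 2 ^ Suc N" using that by (simp del: power_Suc)
      then have "of_nat (2 ^ k) \<noteq> (of_nat (2 ^ Suc N) :: complex)" unfolding of_nat_eq_iff .
      then show ?thesis by (simp add: u_def)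
    qed
    ultimately show ?thesis using scalar_comm_ideal_iff by blast
  qed
  \<comment> \<open>The top coefficient is left; it is read off at \<open>t = 1\<close>.\<close>
  have "(\<Sum>k\<le>N. c k) \<in> comm_ideal q" by (rule comm_ideal_sum) (simp add: low)
  from comm_ideal_diff[OF Suc.prems(1)[of 1] this] have "c (Suc N) \<in> comm_ideal q"
    by (simp add: scalar_1)
  then show ?case using low Suc.prems(2) le_Suc_eq by metis
qed

text \<open>Every letter goes to a polynomial of degree at most one in \<open>t\<close>, so by the
  Leibniz rule the linear coefficient of the product is the derivation. All large \<open>N\<close>
  are allowed so that two expansions can be added over a common range.\<close>

lemma gl_act_expansion:
  fixes T :: "complex \<Rightarrow> complex^'n^'n"
  assumes T: "\<And>t i. gl_act (T t) (var i) = var i + scalar t * d i"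
  shows "\<exists>N0 c. c 0 = f \<and> c 1 = der d f \<and>
    (\<forall>N\<ge>N0. \<forall>t. gl_act (T t) f = (\<Sum>k\<le>N. scalar (t ^ k) * c k))"
proof (induction f rule: free_alg_induct)
  case (single w a)
  show ?case
  proof (induction w)
    case Nil
    show ?case
      by (rule exI[of _ 0], rule exI[of _ "\<lambda>k. if k = 0 then scalar a else 0"])
        (simp add: single_Nil der_scalar if_distrib[of "(*) _"] scalar_1 cong: if_cong)
  next
    case (Cons i w)
    let ?g = "Poly_Mapping.single w a"
    from Cons obtain N0 c where c: "c 0 = ?g" "c 1 = der d ?g"
      and exp: "\<And>N t. N \<ge> N0 \<Longrightarrow> gl_act (T t) ?g = (\<Sum>k\<le>N. scalar (t ^ k) * c k)" by blast
    \<comment> \<open>The coefficients after multiplication by \<open>scalar t * d i\<close>: the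
      factor \<open>t\<close> shifts the index, whence \<open>0\<close> at index \<open>0\<close>
      and the bound \<open>Suc N0\<close>.\<close>
    define e where "e k = (case k of 0 \<Rightarrow> 0 | Suc k \<Rightarrow> d i * c k)" for k
    define c' where "c' k = var i * c k + e k" for k
    have exp': "gl_act (T t) (Poly_Mapping.single (i # w) a) = (\<Sum>k\<le>N. scalar (t ^ k) * c' k)"
      if N: "N \<ge> Suc N0" for N t
    proof -
      obtain M where M: "N = Suc M" "M \<ge> N0" using N by (cases N) auto
      have "(\<Sum>k\<le>N. scalar (t ^ k) * e k) = (\<Sum>k\<le>M. scalar t * (d i * (scalar (t ^ k) * c k)))"
        unfolding M(1) sum.atMost_Suc_shift
        by (simp add: e_def scalar_left_commute[of "d i"] scalar_mult mult.assoc)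
      also have "\<dots> = scalar t * (d i * gl_act (T t) ?g)"
        by (simp only: exp[OF M(2)] sum_distrib_left)
      finally have 1: "(\<Sum>k\<le>N. scalar (t ^ k) * e k) = scalar t * (d i * gl_act (T t) ?g)" .
      have "(\<Sum>k\<le>N. scalar (t ^ k) * (var i * c k)) = (\<Sum>k\<le>N. var i * (scalar (t ^ k) * c k))"
        by (simp only: scalar_left_commute[of "var i"])
      also have "\<dots> = var i * gl_act (T t) ?g"
        using exp[of N t] N by (simp add: sum_distrib_left)
      finally have "(\<Sum>k\<le>N. scalar (t ^ k) * c' k)
          = var i * gl_act (T t) ?g + scalar t * (d i * gl_act (T t) ?g)"
        using 1 by (simp only: c'_def distrib_left sum.distrib)
      then show ?thesis by (simp add: single_Cons gl_act_mult T distrib_right mult.assoc)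
    qed
    have "c' 0 = Poly_Mapping.single (i # w) a"
      by (simp add: c'_def e_def c(1) single_Cons)
    moreover have "c' 1 = der d (Poly_Mapping.single (i # w) a)"
      unfolding c'_def c(2) by (simp add: e_def c(1) single_Cons der_mult der_var)
    ultimately show ?case
      by (intro exI[of _ "Suc N0"] exI[of _ c'] conjI allI impI exp')
  qed
next
  case (sum f g)
  from sum(1) obtain N0 c where c: "c 0 = f" "c 1 = der d f"
    and exp_f: "\<And>N t. N \<ge> N0 \<Longrightarrow> gl_act (T t) f = (\<Sum>k\<le>N. scalar (t ^ k) * c k)" by blast
  from sum(2) obtain N1 e where e: "e 0 = g" "e 1 = der d g"
    and exp_g: "\<And>N t. N \<ge> N1 \<Longrightarrow> gl_act (T t) g = (\<Sum>k\<le>N. scalar (t ^ k) * e k)" by blast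
  have "gl_act (T t) (f + g) = (\<Sum>k\<le>N. scalar (t ^ k) * (c k + e k))" if "max N0 N1 \<le> N" for N t
    using exp_f[of N t] exp_g[of N t] that by (simp add: gl_act_add distrib_left sum.distrib)
  moreover have "c 0 + e 0 = f + g" "c 1 + e 1 = der d (f + g)"
    by (simp_all only: c e der_add)
  ultimately show ?case
    by (intro exI[of _ "max N0 N1"] exI[of _ "\<lambda>k. c k + e k"] conjI allI impI)
qed

text \<open>Invariance is differentiated at \<open>t = 0\<close>: all values of the polynomial
  \<open>gl_act (T t) f - f\<close> lie in the ideal, hence so does its linear coefficient.\<close>

lemma der_comm_ideal_if_invariant:
  fixes T :: "complex \<Rightarrow> complex^'n^'n"
  assumes T: "\<And>t i. gl_act (T t) (var i) = var i + scalar t * d i"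
    and inv: "\<And>t. gl_act (T t) f - f \<in> comm_ideal q"
  shows "der d f \<in> comm_ideal q"
proof -
  obtain N c where c: "c 0 = f" "c 1 = der d f"
    and exp: "\<forall>M\<ge>N. \<forall>t. gl_act (T t) f = (\<Sum>k\<le>M. scalar (t ^ k) * c k)"
    using gl_act_expansion[of T d f, OF T] by blast
  \<comment> \<open>The constant term \<open>f\<close> is dropped. Summing up to
    \<open>Suc N\<close> ensures that the index \<open>1\<close> occurs even if
    \<open>N = 0\<close>.\<close>
  define e where "e = c(0 := 0)"
  have "(\<Sum>k\<le>Suc N. scalar (t ^ k) * e k) = gl_act (T t) f - f" for t
  proof -
    have "gl_act (T t) f = (\<Sum>k\<le>Suc N. scalar (t ^ k) * c k)" using exp by (meson le_Suc_eq order_refl)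
    then show ?thesis
      unfolding sum.atMost_Suc_shift by (simp add: e_def c scalar_1)
  qed
  then have "e 1 \<in> comm_ideal q"
    using inv by (intro polynomial_coeffs_comm_ideal[where N = "Suc N" and c = e]) auto
  then show ?thesis by (simp add: e_def flip: c(2))
qed


section \<open>Invariants of the unitriangular group\<close>

definition transvection :: "'n \<Rightarrow> 'n \<Rightarrow> complex \<Rightarrow> complex^'n^'n" where
  "transvection m j t = (\<chi> a b. if a = b then 1 else if a = m \<and> b = j then t else 0)"

lemma transvection_mult:
  assumes "m \<noteq> j"
  shows "transvection m j t ** B = (\<chi> a b. B $ a $ b + (if a = m then t * B $ j $ b else 0))"
proof -
  have "(\<Sum>k\<in>UNIV. transvection m j t $ a $ k * B $ k $ b)
      = (\<Sum>k\<in>UNIV. (if k = a then B $ a $ b else 0) + (if k = j then (if a = m then t * B $ j $ b else 0) else 0))"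
    for a b
    by (rule sum.cong) (use assms in \<open>auto simp: transvection_def\<close>)
  then show ?thesis by (simp add: matrix_matrix_mult_def sum.distrib)
qed

lemma transvection_in_UT:
  fixes m j :: "'n::{finite,linorder}"
  assumes "m < j"
  shows "transvection m j t \<in> UT"
proof -
  have inv: "transvection m j t ** transvection m j (- t) = mat 1" for t
    unfolding transvection_mult[OF less_imp_neq[OF assms]] vec_eq_iff
    using less_imp_neq[OF assms] by (simp add: transvection_def mat_def)
  have "invertible (transvection m j t)"
    unfolding invertible_def
    by (rule exI[of _ "transvection m j (- t)"]) (use inv[of t] inv[of "- t"] in simp)
  with assms show ?thesis by (auto simp: UT_def GL_def transvection_def)
qed

lemma gl_act_transvection_var:
  assumes "m \<noteq> j"
  shows "gl_act (transvection m j t) (var i) = var i + scalar t * (if i = j then var m else 0)"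
proof -
  have "gl_act (transvection m j t) (var i)
      = (\<Sum>k\<in>UNIV. (if k = i then var i else 0) + (if k = m then scalar t * (if i = j then var m else 0) else 0))"
    unfolding gl_act_var linear_form_def
    by (rule sum.cong) (use assms in \<open>auto simp: transvection_def column_def scalar_0 scalar_1\<close>)
  then show ?thesis by (simp add: sum.distrib)
qed

text \<open>The operator trades one letter \<open>j\<close> for \<open>m\<close> and so shifts
  multidegrees injectively. Membership of the image of \<open>f\<close> in the ideal thus passes to
  single components.\<close>

lemma restr_mset_der:
  fixes f :: "'n free_alg"
  assumes "j \<in># \<mu>"
  shows "der (\<lambda>i. if i = j then var m else 0) (restr (\<lambda>w. mset w = \<mu>) f)
    = restr (\<lambda>w. mset w = add_mset m (\<mu> - {#j#})) (der (\<lambda>i. if i = j then var m else 0) f)"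
    (is "?E (restr _ f) = restr ?P (?E f)")
proof (induction f rule: free_alg_induct)
  case (single w a)
  have "?P v \<longleftrightarrow> mset w = \<mu>"
    if v: "v \<in> Poly_Mapping.keys (?E (Poly_Mapping.single w a))" for v
  proof -
    obtain u where "u \<in> Poly_Mapping.keys (Poly_Mapping.single w a)"
      and v': "v \<in> Poly_Mapping.keys (der_word (\<lambda>i. if i = j then var m else 0) u)"
      using v by (rule keys_der)
    then have "u = w" by (simp split: if_splits)
    from v' obtain w1 i z w2 where "u = w1 @ i # w2" "v = w1 @ z @ w2"
      "z \<in> Poly_Mapping.keys (if i = j then var m else (0 :: 'n free_alg))"
      by (rule keys_der_word)
    \<comment> \<open>The lost letter \<open>j\<close> is added back on both sides, which removes
      the multiset difference.\<close>
    then have "add_mset j (mset v) = add_mset m (mset w)"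
      using \<open>u = w\<close> by (auto simp: var_def split: if_splits)
    moreover have "?P v \<longleftrightarrow> add_mset j (mset v) = add_mset j (add_mset m (\<mu> - {#j#}))" by simp
    moreover have "add_mset j (add_mset m (\<mu> - {#j#})) = add_mset m \<mu>"
      using assms by (simp add: add_mset_commute)
    ultimately show ?thesis by simp
  qed
  then show ?case
    by (cases "mset w = \<mu>") (simp_all add: restr_single restr_id restr_eq_0 der_0)
qed (simp add: restr_add der_add)

text \<open>Representatives of the invariants, so that the argument can stay in the free algebra;
  they are fixed only modulo the ideal.\<close>

definition invariant_mod :: "nat \<Rightarrow> (complex^'n^'n) set \<Rightarrow> 'n free_alg set" where
  "invariant_mod p G = {f. \<forall>A\<in>G. gl_act A f - f \<in> comm_ideal (Suc p)}"

text \<open>In the column of the least index there is nothing above the diagonal, and everything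
  below it vanishes.\<close>

lemma gl_act_UT_var_Min:
  assumes "A \<in> UT"
  shows "gl_act A (var (Min UNIV)) = var (Min UNIV)"
proof -
  have "A $ i $ Min UNIV = (if i = Min UNIV then 1 else 0)" for i
    using assms Min_le[of UNIV i] by (auto simp: UT_def order.order_iff_strict)
  then have "gl_act A (var (Min UNIV)) = (\<Sum>i\<in>UNIV. if i = Min UNIV then var i else 0)"
    unfolding gl_act_var linear_form_def
    by (intro sum.cong) (simp_all add: column_def scalar_0 scalar_1)
  then show ?thesis by simp
qed

text \<open>If the degree in the least variable is at least \<open>p\<close>, the variable can be
  pulled out. Otherwise some other variable has larger degree, the weight is negative, and the
  raising operator forces the component into the ideal, so the cofactor \<open>0\<close>
  works.\<close>

lemma invariant_component_split:
  fixes f :: "'n::{finite,linorder} free_alg"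
  assumes f: "f \<in> invariant_mod p UT" and size: "CARD('n) * (p - 1) < size \<mu>"
  shows "\<exists>g. restr (\<lambda>w. mset w = \<mu>) f - var (Min UNIV) * g \<in> comm_ideal (Suc p)"
proof -
  let ?m = "Min UNIV :: 'n" and ?f = "restr (\<lambda>w. mset w = \<mu>) f"
  have keys: "mset w = \<mu>" if "w \<in> Poly_Mapping.keys ?f" for w
    using that by (simp add: keys_restr)
  show ?thesis
  proof (cases "p \<le> count \<mu> ?m")
    case True
    then show ?thesis using keys by (intro split_var) auto
  next
    case False
    \<comment> \<open>Pigeonhole: \<open>n\<close> exponents of at most \<open>p - 1\<close> add up
      to at most \<open>n (p - 1)\<close>.\<close>
    have "\<exists>j. p \<le> count \<mu> j"
    proof (rule ccontr)
      assume "\<not> (\<exists>j. p \<le> count \<mu> j)"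
      then have lt: "count \<mu> j < p" for j by (simp add: not_le)
      have "count \<mu> j \<le> p - 1" for j using lt[of j] by linarith
      then have "(\<Sum>j\<in>UNIV. count \<mu> j) \<le> (\<Sum>j\<in>(UNIV :: 'n set). p - 1)"
        by (intro sum_mono)
      moreover have "size \<mu> = (\<Sum>j\<in>UNIV. count \<mu> j)"
        unfolding size_multiset_overloaded_eq
        by (rule sum.mono_neutral_left) (auto simp: not_in_iff)
      ultimately show False using size by simp
    qed
    then obtain j where j: "p \<le> count \<mu> j" ..
    with False have "j \<noteq> ?m" by auto
    then have "?m < j" by (simp add: order.strict_iff_order)
    have "j \<in># \<mu>" using j False by (simp flip: count_greater_zero_iff)
    have "der (\<lambda>i. if i = j then var ?m else 0) f \<in> comm_ideal (Suc p)"
    proof (rule der_comm_ideal_if_invariant)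
      show "gl_act (transvection ?m j t) (var i) = var i + scalar t * (if i = j then var ?m else 0)"
        for t i using \<open>j \<noteq> ?m\<close> by (intro gl_act_transvection_var) simp
      show "gl_act (transvection ?m j t) f - f \<in> comm_ideal (Suc p)" for t
        using f transvection_in_UT[OF \<open>?m < j\<close>] by (simp add: invariant_mod_def)
    qed
    then have "der (\<lambda>i. if i = j then var ?m else 0) ?f \<in> comm_ideal (Suc p)"
      unfolding restr_mset_der[OF \<open>j \<in># \<mu>\<close>] by (rule restr_comm_ideal[OF mset_append])
    then have "?f \<in> comm_ideal (Suc p)"
      using \<open>j \<noteq> ?m\<close> j False keys
      by (intro raising_injective[of ?m j ?f "count \<mu> ?m" "count \<mu> j"]) auto
    then show ?thesis by (intro exI[of _ 0]) simp
  qed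
qed

text \<open>The multidegree components are split one by one. The cofactor of their sum is invariant
  because the least variable is fixed and can be cancelled modulo the ideal.\<close>

lemma invariant_split:
  fixes f :: "'n::{finite,linorder} free_alg"
  assumes f: "f \<in> invariant_mod p UT" "f \<in> homogeneous (Suc d)"
    and d: "CARD('n) * (p - 1) < Suc d"
  obtains g where "g \<in> invariant_mod p UT" "g \<in> homogeneous d"
    "f - var (Min UNIV) * g \<in> comm_ideal (Suc p)"
proof -
  let ?m = "Min UNIV :: 'n"
  let ?W = "mset ` Poly_Mapping.keys f"
  have "\<exists>g. restr (\<lambda>w. mset w = \<mu>) f - var ?m * g \<in> comm_ideal (Suc p)" if "\<mu> \<in> ?W" for \<mu>
    using that f d by (intro invariant_component_split) (auto simp: homogeneous_def)
  then obtain g where g: "\<And>\<mu>. \<mu> \<in> ?W \<Longrightarrow>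
      restr (\<lambda>w. mset w = \<mu>) f - var ?m * g \<mu> \<in> comm_ideal (Suc p)" by metis
  have "(\<Sum>\<mu>\<in>?W. restr (\<lambda>w. mset w = \<mu>) f - var ?m * g \<mu>) \<in> comm_ideal (Suc p)"
    by (rule comm_ideal_sum) (rule g)
  then have "f - var ?m * sum g ?W \<in> comm_ideal (Suc p)"
    by (simp add: sum_subtractf sum_restr sum_distrib_left)
  then have "restr (\<lambda>w. length w = Suc d) (f - var ?m * sum g ?W) \<in> comm_ideal (Suc p)"
    by (rule restr_comm_ideal[OF length_append])
  \<comment> \<open>The cofactor is cut down to degree \<open>d\<close>; left multiplication by the
    variable turns this into the part of degree \<open>Suc d\<close>.\<close>
  moreover define h where "h = restr (\<lambda>w. length w = d) (sum g ?W)"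
  moreover have "restr (\<lambda>w. length w = Suc d) f = f"
    using f(2) by (intro restr_id) (simp add: homogeneous_def)
  ultimately have h: "f - var ?m * h \<in> comm_ideal (Suc p)"
    by (simp add: restr_diff var_def restr_single_mult)
  have "gl_act A h - h \<in> comm_ideal (Suc p)" if A: "A \<in> UT" for A
  proof (rule var_mult_comm_ideal)
    have "gl_act A f - f \<in> comm_ideal (Suc p)" using f(1) A by (simp add: invariant_mod_def)
    \<comment> \<open>With \<open>x\<close> fixed by \<open>A\<close>,
      \<open>x (A h - h) = (A f - f) - A (f - x h) + (f - x h)\<close>.\<close>
    from comm_ideal_add[OF comm_ideal_diff[OF this gl_act_comm_ideal[OF h, of A]] h]
    show "var ?m * (gl_act A h - h) \<in> comm_ideal (Suc p)"
      by (simp add: gl_act_diff gl_act_mult gl_act_UT_var_Min[OF A] right_diff_distrib)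
  qed
  then have "h \<in> invariant_mod p UT" by (simp add: invariant_mod_def)
  moreover have "h \<in> homogeneous d" by (simp add: h_def homogeneous_def keys_restr)
  ultimately show ?thesis using h by (rule that)
qed

lemma restr_length_invariant:
  assumes "f \<in> invariant_mod p G"
  shows "restr (\<lambda>w. length w = d) f \<in> invariant_mod p G"
proof -
  have "restr (\<lambda>w. length w = d) (gl_act A f - f) \<in> comm_ideal (Suc p)" if "A \<in> G" for A
    using assms that by (intro restr_comm_ideal[OF length_append]) (simp add: invariant_mod_def)
  then show ?thesis by (simp add: invariant_mod_def restr_diff restr_gl_act)
qed

section \<open>The quotient algebra and its ring of invariants\<close>

lemma proj_eq_iff: "proj p f = proj p g \<longleftrightarrow> f - g \<in> comm_ideal (Suc p)"
proof
  assume "proj p f = proj p g"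
  moreover have "f \<in> proj p f" unfolding proj_eq using comm_ideal_zero by force
  ultimately show "f - g \<in> comm_ideal (Suc p)" by (auto simp: proj_eq)
next
  assume fg: "f - g \<in> comm_ideal (Suc p)"
  have "h + f \<in> proj p g" if "h \<in> comm_ideal (Suc p)" for h
    unfolding proj_eq using comm_ideal_add[OF that fg] by (intro image_eqI[of _ _ "h + (f - g)"]) simp_all
  moreover have "h + g \<in> proj p f" if "h \<in> comm_ideal (Suc p)" for h
    unfolding proj_eq using comm_ideal_diff[OF that fg] by (intro image_eqI[of _ _ "h - (f - g)"]) simp_all
  ultimately show "proj p f = proj p g" by (auto simp: proj_eq)
qed

lemma proj_ring_hom: "proj p \<in> ring_hom free_ring (rel_free p)"
  unfolding rel_free_def proj_def by (rule ideal.rcos_ring_hom[OF ideal_comm_ideal])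

lemma proj_mult: "proj p f \<otimes>\<^bsub>rel_free p\<^esub> proj p g = proj p (f * g)"
  using ring_hom_mult[OF proj_ring_hom[of p], of f g] by (simp add: ring_of_type_algebra_def)

lemma proj_add: "proj p f \<oplus>\<^bsub>rel_free p\<^esub> proj p g = proj p (f + g)"
  using ring_hom_add[OF proj_ring_hom[of p], of f g] by (simp add: ring_of_type_algebra_def)

lemma proj_one: "\<one>\<^bsub>rel_free p\<^esub> = proj p 1"
  using ring_hom_one[OF proj_ring_hom[of p], symmetric] by (simp add: ring_of_type_algebra_def)

lemma proj_zero: "\<zero>\<^bsub>rel_free p\<^esub> = proj p 0"
  using ring_hom_zero[OF proj_ring_hom[of p] ring_free_ring ring_rel_free, symmetric]
  by (simp add: ring_of_type_algebra_def)

lemma proj_uminus: "\<ominus>\<^bsub>rel_free p\<^esub> proj p f = proj p (- f)"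
  by (rule abelian_group.minus_equality[OF ring.is_abelian_group[OF ring_rel_free]])
    (simp_all add: proj_add proj_zero carrier_rel_free)

lemma carrier_invariants:
  assumes "G \<subseteq> GL"
  shows "carrier (invariants G p) = proj p ` invariant_mod p G"
proof -
  have "gl_act_quot A (proj p f) = proj p f \<longleftrightarrow> gl_act A f - f \<in> comm_ideal (Suc p)" if "A \<in> G" for A f
    using that assms by (simp add: gl_act_proj proj_eq_iff subset_iff)
  then show ?thesis by (auto simp: invariants_def carrier_rel_free invariant_mod_def)
qed

lemma ring_invariants:
  assumes G: "G \<subseteq> GL"
  shows "ring (invariants G p)"
proof -
  have "subring (carrier (invariants G p)) (rel_free p)"
    unfolding carrier_invariants[OF G]
  proof (rule ring.subringI[OF ring_rel_free])
    show "proj p ` invariant_mod p G \<subseteq> carrier (rel_free p)"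
      by (auto simp: carrier_rel_free)
    show "\<one>\<^bsub>rel_free p\<^esub> \<in> proj p ` invariant_mod p G"
      by (simp add: proj_one invariant_mod_def comm_ideal_zero)
  next
    fix C assume "C \<in> proj p ` invariant_mod p G"
    then obtain f where f: "C = proj p f" "f \<in> invariant_mod p G" by blast
    have "gl_act A (- f) - (- f) \<in> comm_ideal (Suc p)" if "A \<in> G" for A
      using f(2) that comm_ideal_uminus[of "gl_act A f - f"] by (simp add: invariant_mod_def gl_act_uminus)
    then show "\<ominus>\<^bsub>rel_free p\<^esub> C \<in> proj p ` invariant_mod p G"
      by (simp add: f(1) proj_uminus invariant_mod_def)
  next
    fix C D assume "C \<in> proj p ` invariant_mod p G" "D \<in> proj p ` invariant_mod p G"
    then obtain f g where f: "C = proj p f" "f \<in> invariant_mod p G"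
      and g: "D = proj p g" "g \<in> invariant_mod p G" by blast
    have "gl_act A (f * g) - f * g \<in> comm_ideal (Suc p)" if A: "A \<in> G" for A
    proof -
      \<comment> \<open>The sum telescopes to
        \<open>gl_act A f * gl_act A g - f * g\<close>.\<close>
      have "(gl_act A f - f) * gl_act A g + f * (gl_act A g - g) \<in> comm_ideal (Suc p)"
        using f(2) g(2) A
        by (intro comm_ideal_add comm_ideal_left comm_ideal_right) (simp_all add: invariant_mod_def)
      then show ?thesis by (simp add: gl_act_mult algebra_simps)
    qed
    then show "C \<otimes>\<^bsub>rel_free p\<^esub> D \<in> proj p ` invariant_mod p G"
      by (simp add: f(1) g(1) proj_mult invariant_mod_def)
    have "gl_act A (f + g) - (f + g) \<in> comm_ideal (Suc p)" if A: "A \<in> G" for A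
    proof -
      have "(gl_act A f - f) + (gl_act A g - g) \<in> comm_ideal (Suc p)"
        using f(2) g(2) A by (intro comm_ideal_add) (simp_all add: invariant_mod_def)
      then show ?thesis by (simp add: gl_act_add algebra_simps)
    qed
    then show "C \<oplus>\<^bsub>rel_free p\<^esub> D \<in> proj p ` invariant_mod p G"
      by (simp add: f(1) g(1) proj_add invariant_mod_def)
  qed
  then show ?thesis
    using ring.subring_is_ring[OF ring_rel_free] by (fastforce simp: invariants_def)
qed

text \<open>Induction on the degree: up to \<open>i\<close> the homogeneous invariants are
  generators, and above \<open>i\<close> each is the least variable times an invariant of smaller
  degree. Other invariants are sums of their components, which are invariant too.\<close>

lemma generate_ring_invariants_UT:
  fixes i p :: nat
    and U :: "(complex^'n::{finite,linorder}^'n::_) set"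
  defines "U \<equiv> UT"
  defines "R \<equiv> invariants U p" and "S \<equiv> (\<Union>j\<le>i. invariants_component U p j)"
  assumes i: "CARD('n) * (p - 1) \<le> i" "1 \<le> i"
  shows "generate_ring R (range (\<lambda>c. proj p (scalar c)) \<union> S) = carrier R"
proof -
  let ?K = "range (\<lambda>c. proj p (scalar c) :: 'n free_alg set)"
  let ?gen = "generate_ring R (?K \<union> S)" and ?m = "Min UNIV :: 'n"
  have UT_GL: "U \<subseteq> GL" by (auto simp: U_def UT_def)
  note carrier = carrier_invariants[OF UT_GL, of p, folded R_def]
  have mult: "C \<otimes>\<^bsub>R\<^esub> D = C \<otimes>\<^bsub>rel_free p\<^esub> D" and add: "C \<oplus>\<^bsub>R\<^esub> D = C \<oplus>\<^bsub>rel_free p\<^esub> D" for C D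
    by (simp_all add: R_def invariants_def)
  have S: "proj p f \<in> S" if "f \<in> invariant_mod p U" "f \<in> homogeneous d" "d \<le> i" for f d
    using that carrier by (auto simp: S_def invariants_component_def R_def)
  have homog: "proj p f \<in> ?gen" if "f \<in> invariant_mod p U" "f \<in> homogeneous d" for f d
    using that
  proof (induction d arbitrary: f)
    case 0
    then show ?case using S by (blast intro: generate_ring.incl)
  next
    case (Suc d)
    show ?case
    proof (cases "Suc d \<le> i")
      case True
      with Suc.prems S show ?thesis by (blast intro: generate_ring.incl)
    next
      case False
      with i have "CARD('n) * (p - 1) < Suc d" by linarith
      with Suc.prems obtain g where g: "g \<in> invariant_mod p U" "g \<in> homogeneous d"
        "f - var ?m * g \<in> comm_ideal (Suc p)" unfolding U_def by (rule invariant_split)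
      have "var ?m \<in> invariant_mod p U"
        by (simp add: U_def invariant_mod_def gl_act_UT_var_Min comm_ideal_zero)
      \<comment> \<open>The least variable is itself a generator because
        \<open>1 \<le> i\<close>.\<close>
      then have "proj p (var ?m) \<in> ?gen"
        using S[OF _ homogeneous_var i(2)] by (blast intro: generate_ring.incl)
      from generate_ring.eng_mult[OF this Suc.IH[OF g(1,2)]] g(3) show ?thesis
        by (simp add: mult proj_mult flip: proj_eq_iff)
    qed
  qed
  have "proj p f \<in> ?gen" if f: "f \<in> invariant_mod p U" for f
  proof -
    have "proj p (\<Sum>d\<in>D. restr (\<lambda>w. length w = d) f) \<in> ?gen" if "finite D" for D
      using that
    proof (induction D)
      case empty
      \<comment> \<open>The empty sum is obtained as the scalar \<open>0\<close>.\<close>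
      have "proj p (scalar 0) \<in> ?gen" by (rule generate_ring.incl) simp
      then show ?case by (simp add: scalar_0)
    next
      case (insert d D)
      have "proj p (restr (\<lambda>w. length w = d) f) \<in> ?gen"
        by (rule homog[of _ d])
          (simp_all add: restr_length_invariant f, simp add: homogeneous_def keys_restr)
      from generate_ring.eng_add[OF this insert.IH] insert.hyps show ?case
        by (simp add: add proj_add)
    qed
    from this[of "length ` Poly_Mapping.keys f"] show ?thesis by (simp add: sum_restr)
  qed
  then have "carrier R \<subseteq> ?gen" by (auto simp: carrier)
  moreover have "?K \<union> S \<subseteq> carrier R"
    by (auto simp: carrier S_def invariants_component_def invariant_mod_def comm_ideal_zero
        carrier_invariants[OF UT_GL])
  then have "?gen \<subseteq> carrier R"
    using ring_invariants[OF UT_GL] unfolding R_def by (intro ring.generate_ring_incl)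
  ultimately show ?thesis by blast
qed

theorem corollary4p7:
  fixes p :: nat
  assumes "p \<ge> 1"
  shows "beta_invariants (UT :: (complex^'n::{finite,linorder}^'n::_) set) p
           \<le> (if p > 1 then enat (CARD('n) * (p - 1)) else 1)"
proof -
  \<comment> \<open>For \<open>p > 1\<close> the product is at least \<open>1\<close>; for
    \<open>p = 1\<close> it is \<open>0\<close>, and \<open>1\<close> is needed to include the least
    variable.\<close>
  define i where "i = (if p > 1 then CARD('n) * (p - 1) else 1)"
  have "CARD('n) * (p - 1) \<le> i" "1 \<le> i"
    by (auto simp: i_def Suc_le_eq)
  from generate_ring_invariants_UT[OF this]
  have "beta_invariants (UT :: (complex^'n::_^'n::_) set) p \<le> enat i"
    unfolding beta_invariants_def beta_def by (intro Inf_lower imageI CollectI exI conjI) auto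
  then show ?thesis by (simp add: i_def one_enat_def split: if_splits)
qed

end
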